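(* Suppose we observe $y\sim\mathrm{N}_n(\theta_0,\mathrm{I}_n)$ and the normal means model $y_i=\theta_i+\epsilon_i$, $\epsilon_i\sim\mathrm{N}(0,1)$ independently, $1\le i\le n$, is fitted with the global-local prior $$\theta_j\mid\psi_j,\tau\ \overset{\text{ind.}}{\sim}\ \mathrm{N}(0,\psi_j\tau),\quad \psi_j\overset{\text{i.i.d.}}{\sim} f,\quad j=1,\dots,n,\qquad \tau\sim g,$$ where $g\in\mathcal{G}$ and $f\equiv\mathrm{Exp}(\lambda)$ for some constant $\lambda>0$. Assume $\theta_0\in\ell_0[q_n;n]$ with $q_n=1$ and $\|\theta_0\|_2^2/\log n\to\infty$. Then, for any constant $A>0$, $$\mathbb{E}_{n,\theta_0}\,\mathbb{P}\big(\|\theta-\theta_0\|_2\le\sqrt{A\log n}\mid y\big)\to0\quad\text{as } n\to\infty.$$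
   Context: $\|\cdot\|_2$ is the Euclidean norm; $\mathrm{Exp}(\lambda)$ is the exponential distribution. $\ell_0[q;n]=\{\theta\in\mathbb{R}^n:\#\{1\le j\le n:\theta_j\ne0\}\le q\}$. $\theta_0=\theta_0^{(n)}$ is a sequence of true parameters. The class $\mathcal{G}$ consists of probability densities $g$ on $(0,\infty)$ for which there is a constant $M>0$ with (i) $g(\tau)\le M$ for all $\tau\in(0,\infty)$ and (ii) $g(\tau)>1/M$ for all $\tau\in(0,1)$; $g$ and $\lambda$ do not depend on $n$. $\psi_1,\dots,\psi_n,\tau$ are independent. $\mathbb{P}(\cdot\mid y)$ is the posterior distribution of $\theta$ given $y$ under the stated prior and the likelihood $y\mid\theta\sim\mathrm{N}_n(\theta,\mathrm{I}_n)$; $\mathbb{E}_{n,\theta_0}$ is expectation over $y\sim\mathrm{N}_n(\theta_0,\mathrm{I}_n)$. *)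

theory Defs
  imports "HOL-Probability.Probability"
begin

text \<open>
  Vectors in Euclidean n-space are the elements of the space of \<open>\<Pi>\<^sub>M j\<in>{1..n}. borel\<close>, that is,
  functions on \<open>{1..n}\<close> extended by \<^const>\<open>undefined\<close>; their Euclidean norm is
  \<open>L2_set x {1..n}\<close>.
\<close>

definition l0_ball :: "nat \<Rightarrow> nat \<Rightarrow> (nat \<Rightarrow> real) set" where
  "l0_ball q n = {\<theta> \<in> {1..n} \<rightarrow>\<^sub>E UNIV. card {j \<in> {1..n}. \<theta> j \<noteq> 0} \<le> q}"

text \<open>Only the values of \<open>g\<close> on the positive half-line matter.\<close>

definition class_G :: "(real \<Rightarrow> real) set" where
  "class_G = {g \<in> borel_measurable borel.
     (\<forall>t>0. 0 \<le> g t) \<and> (\<integral>\<^sup>+t\<in>{0<..}. ennreal (g t) \<partial>lborel) = 1 \<and>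
     (\<exists>M>0. (\<forall>t>0. g t \<le> M) \<and> (\<forall>t\<in>{0<..<1}. g t > 1 / M))}"

definition positive_law :: "(real \<Rightarrow> real) \<Rightarrow> real measure" where
  "positive_law g = density lborel (\<lambda>t. ennreal (g t) * indicator {0<..} t)"

definition normal_means :: "nat \<Rightarrow> (nat \<Rightarrow> real) \<Rightarrow> (nat \<Rightarrow> real) measure" where
  "normal_means n \<theta> = (\<Pi>\<^sub>M j\<in>{1..n}. density lborel (normal_density (\<theta> j) 1))"

text \<open>
  \<^const>\<open>normal_density\<close> takes the standard deviation, whereas \<open>\<psi> j * \<tau>\<close> is the variance.
\<close>

definition conditional_prior :: "nat \<Rightarrow> (nat \<Rightarrow> real) \<Rightarrow> real \<Rightarrow> (nat \<Rightarrow> real) measure" where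
  "conditional_prior n \<psi> \<tau> =
     (\<Pi>\<^sub>M j\<in>{1..n}. density lborel (normal_density 0 (sqrt (\<psi> j * \<tau>))))"

definition global_local_prior ::
    "(real \<Rightarrow> real) \<Rightarrow> (real \<Rightarrow> real) \<Rightarrow> nat \<Rightarrow> (nat \<Rightarrow> real) measure" where
  "global_local_prior f g n =
     do {
       \<tau> \<leftarrow> positive_law g;
       \<psi> \<leftarrow> (\<Pi>\<^sub>M j\<in>{1..n}. positive_law f);
       conditional_prior n \<psi> \<tau>
     }"

definition likelihood :: "nat \<Rightarrow> (nat \<Rightarrow> real) \<Rightarrow> (nat \<Rightarrow> real) \<Rightarrow> real" where
  "likelihood n \<theta> y = (\<Prod>j\<in>{1..n}. normal_density (\<theta> j) 1 (y j))"

text \<open>Bayes' formula for a prior on the parameter space of the normal means model.\<close>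

definition posterior :: "nat \<Rightarrow> (nat \<Rightarrow> real) measure \<Rightarrow> (nat \<Rightarrow> real) \<Rightarrow> (nat \<Rightarrow> real) measure" where
  "posterior n \<pi> y =
     density \<pi> (\<lambda>\<theta>. ennreal (likelihood n \<theta> y) / (\<integral>\<^sup>+\<theta>'. ennreal (likelihood n \<theta>' y) \<partial>\<pi>))"

end

theory Submission
  imports Defs "HOL-Real_Asymp.Real_Asymp"
begin

text \<open>
  Write \<open>p\<^sub>0\<close> for the density of \<open>y\<close> under the truth \<open>\<theta>\<^sub>0\<close>, whose only nonzero coordinate is \<open>\<mu>\<close>. Given the
  global scale \<open>\<tau>\<close> the coordinates of \<open>\<theta>\<close> are independent under the prior, and so are they under
  the posterior. Split the ball's posterior mass at \<open>\<tau>\<^sub>1 = K ln n / n\<close>.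

  If \<open>\<tau> \<ge> \<tau>\<^sub>1\<close>, the \<open>n - 1\<close> null coordinates are too spread out for their squares to add up to at
  most \<open>A ln n\<close>: a Chernoff bound in each coordinate makes the conditional posterior mass of the
  ball exponentially small in \<open>n\<close>, uniformly in \<open>\<tau>\<close>.

  If \<open>\<tau> < \<tau>\<^sub>1\<close>, the exponential tails of the prior give the ball around \<open>\<mu>\<close> only prior mass
  \<open>2 exp (- \<bar>\<mu>\<bar> sqrt (lam / \<tau>\<^sub>1) / 2)\<close>. The evidence, on the other hand, is bounded below
  deterministically: using only \<open>\<tau>\<close> of order \<open>1 / sqrt n\<close> and the symmetry of the prior, it is at
  least \<open>p\<^sub>0 y * exp (- C (sqrt n + \<bar>\<mu>\<bar> n powr (1/4)))\<close>. Since \<open>\<bar>\<mu>\<bar> / sqrt (ln n)\<close> tends to infinity,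
  \<open>\<bar>\<mu>\<bar> / sqrt \<tau>\<^sub>1\<close> dominates this exponent.
\<close>

section \<open>The prior as a mixture of product measures\<close>

text \<open>A product measure is determined by its values on boxes, and there the indicator is a
  product over coordinates, so the integral factorizes; sigma-finiteness of each factor gives the
  uniqueness. The conditional prior and the law of the data thus become densities over one Lebesgue
  product, to which Tonelli applies.\<close>

lemma PiM_density:
  fixes f :: "'i \<Rightarrow> 'a \<Rightarrow> ennreal"
  assumes "finite I" "product_sigma_finite M"
    and f [measurable]: "\<And>i. f i \<in> borel_measurable (M i)"
    and sf: "\<And>i. sigma_finite_measure (density (M i) (f i))"
  shows "PiM I (\<lambda>i. density (M i) (f i)) = density (PiM I M) (\<lambda>x. \<Prod>i\<in>I. f i (x i))"
proof -
  interpret product_sigma_finite M by fact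
  interpret D: product_sigma_finite "\<lambda>i. density (M i) (f i)"
    using sf by (simp add: product_sigma_finite_def)
  have pm [measurable]: "(\<lambda>x. \<Prod>i\<in>I. f i (x i)) \<in> borel_measurable (PiM I M)"
    by (intro borel_measurable_prod_ennreal) measurable
  show ?thesis
  proof (rule D.PiM_eqI[symmetric])
    show "sets (density (PiM I M) (\<lambda>x. \<Prod>i\<in>I. f i (x i))) = sets (PiM I (\<lambda>i. density (M i) (f i)))"
      by (simp cong: sets_PiM_cong)
    fix A assume A: "\<And>i. i \<in> I \<Longrightarrow> A i \<in> sets (density (M i) (f i))"
    then have A': "\<And>i. i \<in> I \<Longrightarrow> A i \<in> sets (M i)" by simp
    have "emeasure (density (PiM I M) (\<lambda>x. \<Prod>i\<in>I. f i (x i))) (Pi\<^sub>E I A)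
        = (\<integral>\<^sup>+x. (\<Prod>i\<in>I. f i (x i)) * indicator (Pi\<^sub>E I A) x \<partial>PiM I M)"
      using A' by (intro emeasure_density) (auto intro: sets_PiM_I_finite assms)
    also have "\<dots> = (\<integral>\<^sup>+x. (\<Prod>i\<in>I. f i (x i) * indicator (A i) (x i)) \<partial>PiM I M)"
    proof (rule nn_integral_cong)
      fix x assume "x \<in> space (PiM I M)"
      then have "indicator (Pi\<^sub>E I A) x = (\<Prod>i\<in>I. indicator (A i) (x i) :: ennreal)"
        using \<open>finite I\<close> by (auto simp: indicator_def space_PiM PiE_iff extensional_def)
      then show "(\<Prod>i\<in>I. f i (x i)) * indicator (Pi\<^sub>E I A) x = (\<Prod>i\<in>I. f i (x i) * indicator (A i) (x i))"
        by (simp add: prod.distrib)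
    qed
    also have "\<dots> = (\<Prod>i\<in>I. \<integral>\<^sup>+x. f i x * indicator (A i) x \<partial>M i)"
      using A' by (intro product_nn_integral_prod assms) auto
    also have "\<dots> = (\<Prod>i\<in>I. emeasure (density (M i) (f i)) (A i))"
      using A' by (intro prod.cong refl emeasure_density[symmetric]) auto
    finally show "emeasure (density (PiM I M) (\<lambda>x. \<Prod>i\<in>I. f i (x i))) (Pi\<^sub>E I A)
        = (\<Prod>i\<in>I. emeasure (density (M i) (f i)) (A i))" .
  qed (use assms in auto)
qed

interpretation lborel_prod: product_sigma_finite "\<lambda>_. lborel :: real measure"
  by standard

lemma sigma_finite_density_real:
  fixes f :: "real \<Rightarrow> real"
  assumes "f \<in> borel_measurable borel"
  shows "sigma_finite_measure (density lborel (\<lambda>x. ennreal (f x)))"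
  using assms by (subst sigma_finite_measure.sigma_finite_iff_density_finite) (auto intro: lborel.sigma_finite_measure_axioms)

lemma PiM_density_lborel:
  fixes f :: "'i \<Rightarrow> real \<Rightarrow> real"
  assumes "finite I" and f [measurable]: "\<And>i. f i \<in> borel_measurable borel"
  shows "PiM I (\<lambda>i. density lborel (f i))
       = density (PiM I (\<lambda>_. lborel)) (\<lambda>x. \<Prod>i\<in>I. ennreal (f i (x i)))"
  using assms
  by (intro PiM_density lborel_prod.product_sigma_finite_axioms sigma_finite_density_real) auto

text \<open>
  The standard deviation \<open>s\<close> may be nonpositive here: \<open>s = 0\<close> gives the zero density because of
  division by zero, and the sign of \<open>s\<close> is irrelevant.
\<close>

lemma nn_integral_normal_density_le_1:
  "(\<integral>\<^sup>+x. normal_density m s x \<partial>lborel) \<le> 1"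
proof (cases "s = 0")
  case True then show ?thesis by (simp add: normal_density_def)
next
  case False
  have "normal_density m s = normal_density m \<bar>s\<bar>" by (simp add: normal_density_def fun_eq_iff)
  moreover have "(\<integral>\<^sup>+x. normal_density m \<bar>s\<bar> x \<partial>lborel) = ennreal (\<integral>x. normal_density m \<bar>s\<bar> x \<partial>lborel)"
    using False by (intro nn_integral_eq_integral) auto
  ultimately show ?thesis using False by simp
qed

lemma conditional_prior_eq:
  "conditional_prior n \<psi> \<tau> = density (\<Pi>\<^sub>M j\<in>{1..n}. lborel)
     (\<lambda>\<theta>. \<Prod>j\<in>{1..n}. ennreal (normal_density 0 (sqrt (\<psi> j * \<tau>)) (\<theta> j)))"
  unfolding conditional_prior_def by (rule PiM_density_lborel) auto

section \<open>Measurability of the kernel behind the prior\<close>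

lemma measurable_normal_density2 [measurable (raw)]:
  assumes [measurable]: "f \<in> borel_measurable M" "h \<in> borel_measurable M" "s \<in> borel_measurable M"
  shows "(\<lambda>x. normal_density (h x) (s x) (f x)) \<in> borel_measurable M"
  unfolding normal_density_def by measurable

lemma sets_PiM_lborel: "sets (PiM I (\<lambda>_. lborel)) = sets (PiM I (\<lambda>_. borel))"
  by (intro sets_PiM_cong) auto

text \<open>Unfolding the two binds of the prior asks for a measurable kernel. It is only a
  subprobability kernel: a coordinate with \<open>\<psi> j * \<tau> = 0\<close> carries the zero
  density.\<close>

lemma measurable_conditional_prior:
  "(\<lambda>(\<tau>, \<psi>). conditional_prior n \<psi> \<tau>)
     \<in> measurable (borel \<Otimes>\<^sub>M PiM {1..n} (\<lambda>_. borel)) (subprob_algebra (PiM {1..n} (\<lambda>_. borel)))"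
proof (rule measurable_subprob_algebra)
  let ?Q = "PiM {1..n} (\<lambda>_. lborel :: real measure)"
  fix a :: "real \<times> (nat \<Rightarrow> real)"
  obtain \<tau> \<psi> where a: "a = (\<tau>, \<psi>)" by force
  show "sets (case a of (\<tau>, \<psi>) \<Rightarrow> conditional_prior n \<psi> \<tau>) = sets (PiM {1..n} (\<lambda>_. borel))"
    unfolding a conditional_prior_eq by (simp add: sets_PiM_lborel)
  show "subprob_space (case a of (\<tau>, \<psi>) \<Rightarrow> conditional_prior n \<psi> \<tau>)"
  proof
    have "emeasure (conditional_prior n \<psi> \<tau>) (space (conditional_prior n \<psi> \<tau>))
      = (\<integral>\<^sup>+x. (\<Prod>j\<in>{1..n}. ennreal (normal_density 0 (sqrt (\<psi> j * \<tau>)) (x j))) \<partial>?Q)"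
      unfolding conditional_prior_eq by (simp add: emeasure_density cong: nn_integral_cong del: One_nat_def)
    also have "\<dots> = (\<Prod>j\<in>{1..n}. \<integral>\<^sup>+x. ennreal (normal_density 0 (sqrt (\<psi> j * \<tau>)) x) \<partial>lborel)"
      by (rule lborel_prod.product_nn_integral_prod) auto
    also have "\<dots> \<le> 1" by (intro prod_le_1) (auto intro: nn_integral_normal_density_le_1)
    finally show "emeasure (case a of (\<tau>, \<psi>) \<Rightarrow> conditional_prior n \<psi> \<tau>)
       (space (case a of (\<tau>, \<psi>) \<Rightarrow> conditional_prior n \<psi> \<tau>)) \<le> 1" by (simp add: a)
    show "space (case a of (\<tau>, \<psi>) \<Rightarrow> conditional_prior n \<psi> \<tau>) \<noteq> {}"
      by (simp add: a conditional_prior_eq space_PiM PiE_eq_empty_iff)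
  qed
next
  let ?Q = "PiM {1..n} (\<lambda>_. lborel :: real measure)"
  interpret Q: sigma_finite_measure ?Q by (rule lborel_prod.sigma_finite) simp
  fix A :: "(nat \<Rightarrow> real) set" assume "A \<in> sets (PiM {1..n} (\<lambda>_. borel))"
  then have A[measurable]: "A \<in> sets ?Q" by (simp add: sets_PiM_lborel)
  have m[measurable]: "(\<lambda>x. \<Prod>j\<in>{1..n}. ennreal (normal_density 0 (sqrt (\<psi> j * \<tau>)) (x j)))
     \<in> borel_measurable ?Q" for \<tau> :: real and \<psi> :: "nat \<Rightarrow> real"
    by (intro borel_measurable_prod_ennreal) measurable
  have m2[measurable]: "(\<lambda>(p, x). \<Prod>j\<in>{1..n}. ennreal (normal_density 0 (sqrt (snd p j * fst p)) (x j)))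
     \<in> borel_measurable ((borel \<Otimes>\<^sub>M PiM {1..n} (\<lambda>_. borel)) \<Otimes>\<^sub>M ?Q)"
    unfolding split_beta by (intro borel_measurable_prod_ennreal) measurable
  \<comment> \<open>As an integral of a jointly measurable function over the sigma-finite
    \<open>?Q\<close>, the mass of \<open>A\<close> is measurable in the scales.\<close>
  have "(\<lambda>p. emeasure (conditional_prior n (snd p) (fst p)) A)
      = (\<lambda>p. \<integral>\<^sup>+x. (case (p,x) of (p,x) \<Rightarrow> (\<Prod>j\<in>{1..n}. ennreal (normal_density 0 (sqrt (snd p j * fst p)) (x j)))) * indicator A x \<partial>?Q)"
    unfolding conditional_prior_eq by (subst emeasure_density) (auto simp del: One_nat_def)
  also have "\<dots> \<in> borel_measurable (borel \<Otimes>\<^sub>M PiM {1..n} (\<lambda>_. borel))"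
    by measurable
  finally show "(\<lambda>a. emeasure (case a of (\<tau>, \<psi>) \<Rightarrow> conditional_prior n \<psi> \<tau>) A)
     \<in> borel_measurable (borel \<Otimes>\<^sub>M PiM {1..n} (\<lambda>_. borel))" by (simp add: split_beta)
qed

text \<open>
  Density at \<open>x\<close> of a coordinate of the parameter given \<open>\<tau>\<close>, with the local scale \<open>\<psi>\<close> integrated
  out. For exponential \<open>f\<close> it is a Laplace density, but the bounds below avoid the closed form.
\<close>

definition scale_mixture :: "(real \<Rightarrow> real) \<Rightarrow> real \<Rightarrow> real \<Rightarrow> ennreal" where
  "scale_mixture f \<tau> x = (\<integral>\<^sup>+\<psi>. ennreal (normal_density 0 (sqrt (\<psi> * \<tau>)) x) \<partial>positive_law f)"

lemma sets_positive_law [measurable_cong]: "sets (positive_law f) = sets borel"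
  and space_positive_law [simp]: "space (positive_law f) = UNIV"
  by (simp_all add: positive_law_def)

lemma sigma_finite_positive_law:
  assumes [measurable]: "f \<in> borel_measurable borel"
  shows "sigma_finite_measure (positive_law f)"
  unfolding positive_law_def
  by (subst sigma_finite_measure.sigma_finite_iff_density_finite)
     (auto intro: lborel.sigma_finite_measure_axioms simp: ennreal_mult_eq_top_iff indicator_def)

lemma measurable_scale_mixture [measurable (raw)]:
  assumes f: "f \<in> borel_measurable borel"
    and [measurable]: "a \<in> borel_measurable M" "b \<in> borel_measurable M"
  shows "(\<lambda>x. scale_mixture f (a x) (b x)) \<in> borel_measurable M"
proof -
  interpret sigma_finite_measure "positive_law f" by (rule sigma_finite_positive_law) fact
  show ?thesis unfolding scale_mixture_def by measurable
qed

lemma nn_integral_scale_mixture: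
  assumes f: "f \<in> borel_measurable borel" and [measurable]: "F \<in> borel_measurable borel"
  shows "(\<integral>\<^sup>+x. scale_mixture f \<tau> x * F x \<partial>lborel)
    = (\<integral>\<^sup>+\<psi>. (\<integral>\<^sup>+x. ennreal (normal_density 0 (sqrt (\<psi> * \<tau>)) x) * F x \<partial>lborel) \<partial>positive_law f)"
proof -
  interpret P: sigma_finite_measure "positive_law f" by (rule sigma_finite_positive_law) fact
  interpret pair_sigma_finite lborel "positive_law f" ..
  have "(\<integral>\<^sup>+x. scale_mixture f \<tau> x * F x \<partial>lborel)
      = (\<integral>\<^sup>+x. (\<integral>\<^sup>+\<psi>. ennreal (normal_density 0 (sqrt (\<psi> * \<tau>)) x) * F x \<partial>positive_law f) \<partial>lborel)"
    unfolding scale_mixture_def by (intro nn_integral_cong nn_integral_multc[symmetric]) measurable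
  also have "\<dots> = (\<integral>\<^sup>+\<psi>. (\<integral>\<^sup>+x. ennreal (normal_density 0 (sqrt (\<psi> * \<tau>)) x) * F x \<partial>lborel) \<partial>positive_law f)"
    by (intro Fubini'[symmetric]) measurable
  finally show ?thesis .
qed

text \<open>Once the binds are unfolded, Tonelli puts the integral over the local scales innermost.
  They are i.i.d. and each enters only one normal density, so that integral factorizes and
  \<open>\<tau>\<close> alone couples the coordinates.\<close>

lemma nn_integral_global_local_prior:
  assumes f: "f \<in> borel_measurable borel" and "prob_space (positive_law f)"
    and F: "F \<in> borel_measurable (PiM {1..n} (\<lambda>_. borel))"
  shows "(\<integral>\<^sup>+\<theta>. F \<theta> \<partial>global_local_prior f g n)
    = (\<integral>\<^sup>+\<tau>. (\<integral>\<^sup>+\<theta>. (\<Prod>j\<in>{1..n}. scale_mixture f \<tau> (\<theta> j)) * F \<theta> \<partial>PiM {1..n} (\<lambda>_. lborel)) \<partial>positive_law g)"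
proof -
  let ?I = "{1..n}" let ?P = "PiM ?I (\<lambda>_. positive_law f)" let ?Q = "PiM ?I (\<lambda>_. lborel :: real measure)"
  let ?B = "PiM ?I (\<lambda>_. borel :: real measure)"
  interpret P: prob_space "positive_law f" by fact
  interpret PP: product_prob_space "\<lambda>_. positive_law f" ?I by standard
  have pP: "prob_space ?P" by (rule prob_space_PiM) (rule assms(2))
  interpret P': prob_space ?P by (rule pP)
  interpret Q: sigma_finite_measure ?Q by (rule lborel_prod.sigma_finite) simp
  interpret PQ: pair_sigma_finite ?P ?Q ..
  have sP: "sets ?P = sets ?B" by (intro sets_PiM_cong) (auto simp: sets_positive_law)
  have sQ: "sets ?Q = sets ?B" by (rule sets_PiM_lborel)
  have [measurable]: "F \<in> borel_measurable ?Q" using F by (subst measurable_cong_sets[OF sQ refl])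
  have C: "(\<lambda>(\<tau>, \<psi>). conditional_prior n \<psi> \<tau>) \<in> measurable (borel \<Otimes>\<^sub>M ?P) (subprob_algebra ?B)"
    using measurable_conditional_prior
    by (subst measurable_cong_sets[OF sets_pair_measure_cong[OF refl sP] refl])
  have cP: "(\<lambda>_. ?P) \<in> measurable M (subprob_algebra ?P)" for M :: "real measure"
    by (intro measurable_const) (simp add: space_subprob_algebra pP prob_space_imp_subprob_space del: One_nat_def)
  have C1: "(\<lambda>\<psi>. conditional_prior n \<psi> \<tau>) \<in> measurable ?P (subprob_algebra ?B)" for \<tau>
    using measurable_Pair2[OF C, of \<tau>] by simp
  have C2: "(\<lambda>\<tau>. ?P \<bind> (\<lambda>\<psi>. conditional_prior n \<psi> \<tau>)) \<in> measurable (positive_law g) (subprob_algebra ?B)"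
    by (rule measurable_bind'[OF cP], subst measurable_cong_sets[OF sets_pair_measure_cong[OF sets_positive_law refl] refl], rule C)
  have [measurable]: "(\<lambda>(\<psi>, \<theta>). \<Prod>j\<in>?I. ennreal (normal_density 0 (sqrt (\<psi> j * \<tau>)) (\<theta> j))) \<in> borel_measurable (?P \<Otimes>\<^sub>M ?Q)" for \<tau>
    unfolding split_beta by (intro borel_measurable_prod_ennreal) measurable
  have "(\<integral>\<^sup>+\<theta>. F \<theta> \<partial>global_local_prior f g n)
     = (\<integral>\<^sup>+\<tau>. (\<integral>\<^sup>+\<psi>. (\<integral>\<^sup>+\<theta>. F \<theta> \<partial>conditional_prior n \<psi> \<tau>) \<partial>?P) \<partial>positive_law g)"
    unfolding global_local_prior_def
    by (subst nn_integral_bind[OF F C2]) (simp only: nn_integral_bind[OF F C1])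
  also have "\<dots> = (\<integral>\<^sup>+\<tau>. (\<integral>\<^sup>+\<theta>. (\<Prod>j\<in>?I. scale_mixture f \<tau> (\<theta> j)) * F \<theta> \<partial>?Q) \<partial>positive_law g)"
  proof (rule nn_integral_cong)
    fix \<tau>
    have "(\<integral>\<^sup>+\<psi>. (\<integral>\<^sup>+\<theta>. F \<theta> \<partial>conditional_prior n \<psi> \<tau>) \<partial>?P)
       = (\<integral>\<^sup>+\<psi>. (\<integral>\<^sup>+\<theta>. (\<Prod>j\<in>?I. ennreal (normal_density 0 (sqrt (\<psi> j * \<tau>)) (\<theta> j))) * F \<theta> \<partial>?Q) \<partial>?P)"
      unfolding conditional_prior_eq
      by (intro nn_integral_cong nn_integral_density borel_measurable_prod_ennreal) measurable
    also have "\<dots> = (\<integral>\<^sup>+\<theta>. (\<integral>\<^sup>+\<psi>. (\<Prod>j\<in>?I. ennreal (normal_density 0 (sqrt (\<psi> j * \<tau>)) (\<theta> j))) * F \<theta> \<partial>?P) \<partial>?Q)"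
      by (intro PQ.Fubini'[symmetric]) measurable
    also have "\<dots> = (\<integral>\<^sup>+\<theta>. (\<integral>\<^sup>+\<psi>. (\<Prod>j\<in>?I. ennreal (normal_density 0 (sqrt (\<psi> j * \<tau>)) (\<theta> j))) \<partial>?P) * F \<theta> \<partial>?Q)"
      by (intro nn_integral_cong nn_integral_multc borel_measurable_prod_ennreal) measurable
    also have "\<dots> = (\<integral>\<^sup>+\<theta>. (\<Prod>j\<in>?I. scale_mixture f \<tau> (\<theta> j)) * F \<theta> \<partial>?Q)"
      unfolding scale_mixture_def
      by (intro nn_integral_cong arg_cong2[where f="(*)"] PP.product_nn_integral_prod refl) auto
    finally show "(\<integral>\<^sup>+\<psi>. (\<integral>\<^sup>+\<theta>. F \<theta> \<partial>conditional_prior n \<psi> \<tau>) \<partial>?P)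
       = (\<integral>\<^sup>+\<theta>. (\<Prod>j\<in>?I. scale_mixture f \<tau> (\<theta> j)) * F \<theta> \<partial>?Q)" .
  qed
  finally show ?thesis .
qed

lemma sets_global_local_prior:
  assumes f: "f \<in> borel_measurable borel" and "prob_space (positive_law f)"
  shows "sets (global_local_prior f g n) = sets (PiM {1..n} (\<lambda>_. borel))"
proof -
  let ?I = "{1..n}" let ?P = "PiM ?I (\<lambda>_. positive_law f)"
  let ?B = "PiM ?I (\<lambda>_. borel :: real measure)"
  \<comment> \<open>\<open>bind\<close> over an empty space has a default value, hence this fact and
    its analogue for \<open>positive_law g\<close>.\<close>
  have ne: "space ?P \<noteq> {}" by (simp add: space_PiM PiE_eq_empty_iff)
  have sC: "sets (conditional_prior n \<psi> \<tau>) = sets ?B" for \<psi> \<tau>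
    unfolding conditional_prior_eq sets_density by (rule sets_PiM_lborel)
  have *: "sets (?P \<bind> (\<lambda>\<psi>. conditional_prior n \<psi> \<tau>)) = sets ?B" for \<tau>
    using sC ne by (rule sets_bind)
  have "space (positive_law g) \<noteq> {}" by simp
  with * show ?thesis unfolding global_local_prior_def
    by (rule sets_bind)
qed

section \<open>Exponential scale mixtures of normal densities\<close>

lemma positive_law_exponential:
  "positive_law (exponential_density lam) = density lborel (exponential_density lam)"
  unfolding positive_law_def
proof (rule density_cong)
  \<comment> \<open>The densities can differ only at 0, where \<open>exponential_density lam\<close>
    is \<open>lam\<close> and the indicator vanishes.\<close>
  have "AE x in lborel. x \<noteq> (0 :: real)" by (rule AE_lborel_singleton)
  then show "AE x in lborel. ennreal (exponential_density lam x) * indicator {0<..} x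
      = ennreal (exponential_density lam x)"
    by eventually_elim (auto simp: exponential_density_def indicator_def)
qed auto

lemma AE_positive_law_pos:
  assumes [measurable]: "f \<in> borel_measurable borel"
  shows "AE \<psi> in positive_law f. \<psi> > 0"
  unfolding positive_law_def by (subst AE_density) (auto simp: indicator_def)

lemma prob_space_positive_law_exponential:
  "lam > 0 \<Longrightarrow> prob_space (positive_law (exponential_density lam))"
  by (simp add: positive_law_exponential prob_space_exponential_density)

section \<open>Gaussian integrals with quadratic and linear exponents\<close>

lemma nn_integral_normal_density:
  "s > 0 \<Longrightarrow> (\<integral>\<^sup>+x. ennreal (normal_density m s x) \<partial>lborel) = 1"
  by (subst nn_integral_eq_integral) auto

lemma normal_density_mult_exp_square:
  assumes "v > 0" "1 + 2 * k * v > 0"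
  shows "normal_density 0 (sqrt v) x * exp (- k * x\<^sup>2)
    = normal_density 0 (sqrt (v / (1 + 2 * k * v))) x / sqrt (1 + 2 * k * v)"
proof -
  have "- x\<^sup>2 / (2 * v) - k * x\<^sup>2 = - x\<^sup>2 / (2 * (v / (1 + 2 * k * v)))"
    using assms by (simp add: field_simps)
  then have "exp (- x\<^sup>2 / (2 * v)) * exp (- k * x\<^sup>2) = exp (- x\<^sup>2 / (2 * (v / (1 + 2 * k * v))))"
    by (simp add: exp_add [symmetric])
  then show ?thesis using assms
    by (simp add: normal_density_def real_sqrt_divide real_sqrt_mult field_simps)
qed

lemma nn_integral_normal_density_exp_square:
  assumes "v > 0" "1 + 2 * k * v > 0"
  shows "(\<integral>\<^sup>+x. ennreal (normal_density 0 (sqrt v) x) * ennreal (exp (- k * x\<^sup>2)) \<partial>lborel)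
    = ennreal (1 / sqrt (1 + 2 * k * v))"
proof -
  have "(\<integral>\<^sup>+x. ennreal (normal_density 0 (sqrt v) x) * ennreal (exp (- k * x\<^sup>2)) \<partial>lborel)
    = (\<integral>\<^sup>+x. ennreal (1 / sqrt (1 + 2 * k * v)) * ennreal (normal_density 0 (sqrt (v / (1 + 2 * k * v))) x) \<partial>lborel)"
    using assms
    by (intro nn_integral_cong) (simp add: ennreal_mult [symmetric] normal_density_mult_exp_square [simplified])
  also have "\<dots> = ennreal (1 / sqrt (1 + 2 * k * v))"
    using assms by (subst nn_integral_cmult) (auto simp: nn_integral_normal_density)
  finally show ?thesis .
qed

lemma nn_integral_normal_density_exp:
  assumes "v > 0"
  shows "(\<integral>\<^sup>+x. ennreal (normal_density 0 (sqrt v) x) * ennreal (exp (b * x)) \<partial>lborel)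
    = ennreal (exp (b\<^sup>2 * v / 2))"
proof -
  have eq: "normal_density 0 (sqrt v) x * exp (b * x) = exp (b\<^sup>2 * v / 2) * normal_density (b * v) (sqrt v) x" for x
  proof -
    have "- x\<^sup>2 / (2 * v) + b * x = b\<^sup>2 * v / 2 + - (x - b * v)\<^sup>2 / (2 * v)"
      using assms by (simp add: field_simps power2_eq_square)
    then have "exp (- x\<^sup>2 / (2 * v)) * exp (b * x) = exp (b\<^sup>2 * v / 2) * exp (- (x - b * v)\<^sup>2 / (2 * v))"
      by (simp add: exp_add [symmetric])
    then show ?thesis using assms by (simp add: normal_density_def)
  qed
  have "(\<integral>\<^sup>+x. ennreal (normal_density 0 (sqrt v) x) * ennreal (exp (b * x)) \<partial>lborel)
    = (\<integral>\<^sup>+x. ennreal (exp (b\<^sup>2 * v / 2)) * ennreal (normal_density (b * v) (sqrt v) x) \<partial>lborel)"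
    by (intro nn_integral_cong) (simp add: ennreal_mult [symmetric] eq)
  then show ?thesis
    using assms by (simp add: nn_integral_cmult nn_integral_normal_density)
qed

section \<open>Means of inverse square roots under the exponential law\<close>

lemma nn_integral_scale_mixture_exp_square:
  assumes [measurable]: "f \<in> borel_measurable borel" and "\<tau> > 0" "k \<ge> 0"
  shows "(\<integral>\<^sup>+x. scale_mixture f \<tau> x * ennreal (exp (- k * x\<^sup>2)) \<partial>lborel)
    = (\<integral>\<^sup>+\<psi>. ennreal (1 / sqrt (1 + 2 * k * \<tau> * \<psi>)) \<partial>positive_law f)"
proof -
  have "(\<integral>\<^sup>+x. scale_mixture f \<tau> x * ennreal (exp (- k * x\<^sup>2)) \<partial>lborel)
    = (\<integral>\<^sup>+\<psi>. (\<integral>\<^sup>+x. ennreal (normal_density 0 (sqrt (\<psi> * \<tau>)) x) * ennreal (exp (- k * x\<^sup>2)) \<partial>lborel) \<partial>positive_law f)"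
    by (rule nn_integral_scale_mixture) auto
  also have "\<dots> = (\<integral>\<^sup>+\<psi>. ennreal (1 / sqrt (1 + 2 * k * \<tau> * \<psi>)) \<partial>positive_law f)"
  proof (rule nn_integral_cong_AE)
    show "AE \<psi> in positive_law f. (\<integral>\<^sup>+x. ennreal (normal_density 0 (sqrt (\<psi> * \<tau>)) x) * ennreal (exp (- k * x\<^sup>2)) \<partial>lborel)
      = ennreal (1 / sqrt (1 + 2 * k * \<tau> * \<psi>))"
      using AE_positive_law_pos[OF assms(1)]
    proof eventually_elim
      fix \<psi> :: real assume "\<psi> > 0"
      then have "\<psi> * \<tau> > 0" "1 + 2 * k * (\<psi> * \<tau>) > 0" using assms by (auto intro!: add_pos_nonneg)
      from nn_integral_normal_density_exp_square[OF this]
      show "(\<integral>\<^sup>+x. ennreal (normal_density 0 (sqrt (\<psi> * \<tau>)) x) * ennreal (exp (- k * x\<^sup>2)) \<partial>lborel)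
      = ennreal (1 / sqrt (1 + 2 * k * \<tau> * \<psi>))" by (simp add: mult_ac)
    qed
  qed
  finally show ?thesis .
qed

text \<open>For \<open>\<psi> \<le> 1\<close> the exponential density is at most \<open>lam\<close>,
  and \<open>lam / sqrt (1 + c * \<psi>)\<close> has an elementary primitive, which gives
  \<open>2 * lam / sqrt c\<close>; for \<open>\<psi> > 1\<close> the inverse root is at most
  \<open>1 / sqrt c\<close>. The decay in \<open>c\<close> is what makes spread-out null coordinates
  unlikely to be small.\<close>

lemma nn_integral_inverse_sqrt_exponential_le:
  assumes "lam > 0" "c > 0"
  shows "(\<integral>\<^sup>+\<psi>. ennreal (1 / sqrt (1 + c * \<psi>)) \<partial>positive_law (exponential_density lam))
    \<le> ennreal ((2 * lam + 1) / sqrt c)"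
proof -
  let ?e = "exponential_density lam"
  have "(\<integral>\<^sup>+\<psi>. ennreal (1 / sqrt (1 + c * \<psi>)) \<partial>positive_law ?e)
      = (\<integral>\<^sup>+\<psi>. ennreal (?e \<psi>) * ennreal (1 / sqrt (1 + c * \<psi>)) \<partial>lborel)"
    unfolding positive_law_exponential by (rule nn_integral_density) auto
  also have "\<dots> \<le> (\<integral>\<^sup>+\<psi>. ennreal (lam / sqrt (1 + c * \<psi>)) * indicator {0..1} \<psi>
        + ennreal (1 / sqrt c) * ennreal (?e \<psi>) \<partial>lborel)"
  proof (rule nn_integral_mono)
    fix \<psi> :: real
    consider "\<psi> < 0" | "0 \<le> \<psi>" "\<psi> \<le> 1" | "\<psi> > 1" by linarith
    then show "ennreal (?e \<psi>) * ennreal (1 / sqrt (1 + c * \<psi>))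
        \<le> ennreal (lam / sqrt (1 + c * \<psi>)) * indicator {0..1} \<psi> + ennreal (1 / sqrt c) * ennreal (?e \<psi>)"
    proof cases
      case 1 then show ?thesis by (simp add: exponential_density_def)
    next
      case 2
      have "?e \<psi> \<le> lam" using 2 assms by (simp add: exponential_density_def)
      then have "?e \<psi> * (1 / sqrt (1 + c * \<psi>)) \<le> lam * (1 / sqrt (1 + c * \<psi>))"
        using 2 assms by (intro mult_right_mono) auto
      then have "ennreal (?e \<psi>) * ennreal (1 / sqrt (1 + c * \<psi>)) \<le> ennreal (lam / sqrt (1 + c * \<psi>))"
        using 2 assms by (subst ennreal_mult [symmetric]) (auto simp: exponential_density_nonneg intro!: ennreal_leI)
      then show ?thesis using 2 by (auto intro: order_trans)
    next
      case 3
      have "c \<le> 1 + c * \<psi>" using 3 assms by (simp add: add_increasing)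
      then have "1 / sqrt (1 + c * \<psi>) \<le> 1 / sqrt c"
        using assms by (intro divide_left_mono) auto
      then show ?thesis using 3 by (simp add: mult.commute ennreal_leI mult_left_mono)
    qed
  qed
  also have "\<dots> = (\<integral>\<^sup>+\<psi>. ennreal (lam / sqrt (1 + c * \<psi>)) * indicator {0..1} \<psi> \<partial>lborel) + ennreal (1 / sqrt c)"
  proof -
    have "(\<integral>\<^sup>+\<psi>. ennreal (?e \<psi>) \<partial>lborel) = 1"
      using prob_space.emeasure_space_1[OF prob_space_exponential_density[OF assms(1)]]
      by (simp add: emeasure_density)
    then show ?thesis by (subst nn_integral_add) (auto simp: nn_integral_cmult)
  qed
  also have "(\<integral>\<^sup>+\<psi>. ennreal (lam / sqrt (1 + c * \<psi>)) * indicator {0..1} \<psi> \<partial>lborel)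
      = ennreal (2 * lam / c * sqrt (1 + c * 1) - 2 * lam / c * sqrt (1 + c * 0))"
  proof (rule nn_integral_FTC_Icc)
    fix x :: real assume x: "x \<in> {0..1}"
    then have "1 + c * x > 0" using assms by (simp add: add_pos_nonneg)
    then show "((\<lambda>x. 2 * lam / c * sqrt (1 + c * x)) has_real_derivative lam / sqrt (1 + c * x)) (at x)"
      using assms by (auto intro!: derivative_eq_intros simp: field_simps)
    show "0 \<le> lam / sqrt (1 + c * x)" using assms x by simp
  qed auto
  also have "\<dots> \<le> ennreal (2 * lam / sqrt c)"
  proof (rule ennreal_leI)
    have "sqrt (1 + c) \<le> 1 + sqrt c" using sqrt_add_le_add_sqrt[of 1 c] assms by simp
    then have "2 * lam / c * (sqrt (1 + c) - 1) \<le> 2 * lam / c * sqrt c"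
      using assms by (intro mult_left_mono) auto
    also have "\<dots> = 2 * lam / sqrt c" using assms by (simp add: real_div_sqrt field_simps)
    finally show "2 * lam / c * sqrt (1 + c * 1) - 2 * lam / c * sqrt (1 + c * 0) \<le> 2 * lam / sqrt c"
      by (simp add: algebra_simps diff_divide_distrib)
  qed
  also have "ennreal (2 * lam / sqrt c) + ennreal (1 / sqrt c) = ennreal ((2 * lam + 1) / sqrt c)"
    using assms by (subst ennreal_plus [symmetric]) (auto simp: add_divide_distrib)
  finally show ?thesis by (simp add: add_right_mono)
qed

text \<open>Jensen's inequality for the convex function \<open>1 / sqrt w\<close> at
  \<open>w = 1 + \<tau> * \<psi>\<close>, whose mean is \<open>1 + \<tau> / lam\<close>. After
  division by this mean the supporting line is the tangent at 1.\<close>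

lemma nn_integral_inverse_sqrt_exponential_ge:
  assumes "lam > 0" "\<tau> > 0"
  shows "ennreal (1 / sqrt (1 + \<tau> / lam))
    \<le> (\<integral>\<^sup>+\<psi>. ennreal (1 / sqrt (1 + \<tau> * \<psi>)) \<partial>positive_law (exponential_density lam))"
proof -
  let ?P = "positive_law (exponential_density lam)"
  interpret P: prob_space ?P by (rule prob_space_positive_law_exponential) fact
  define a where "a = 1 + \<tau> / lam"
  have a: "a > 0" using assms by (simp add: a_def add_pos_pos)
  have D: "distributed ?P lborel (\<lambda>x. x) (exponential_density lam)"
    by (simp add: distributed_def positive_law_exponential distr_id2)
  have E: "P.expectation (\<lambda>x. x) = 1 / lam" by (rule P.exponential_distributed_expectation[OF assms(1) D])
  have I[simp]: "integrable ?P (\<lambda>x. x)" using P.erlang_ith_moment_integrable[OF assms(1) D, of 1] by simp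
  have [measurable]: "(\<lambda>x. x) \<in> borel_measurable ?P" by (simp cong: measurable_cong_sets add: sets_positive_law)
  have pos: "AE x in ?P. x > 0" by (rule AE_positive_law_pos) simp
  have J: "integrable ?P (\<lambda>x. 1 / sqrt (1 + \<tau> * x))"
  proof (rule P.integrable_const_bound[where B = 1])
    show "AE x in ?P. norm (1 / sqrt (1 + \<tau> * x)) \<le> 1" using pos
    proof eventually_elim
      fix x :: real assume "x > 0"
      then have "\<tau> * x > 0" using assms by simp
      then show "norm (1 / sqrt (1 + \<tau> * x)) \<le> 1" by simp
    qed
  qed measurable
  \<comment> \<open>The tangent of \<open>1 / sqrt w\<close> at \<open>w = 1\<close>; in
    \<open>r = sqrt w\<close> the gap has the double root 1.\<close>
  have tangent: "1 / sqrt w \<ge> 3 / 2 - w / 2" if "w > 0" for w :: real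
  proof -
    define r where "r = sqrt w"
    have r: "r > 0" "w = r\<^sup>2" using that by (auto simp: r_def)
    have "2 + r ^ 3 - 3 * r = (r - 1)\<^sup>2 * (r + 2)" by (simp add: power2_eq_square power3_eq_cube algebra_simps)
    also have "\<dots> \<ge> 0" using r by simp
    finally have "3 * r - r ^ 3 \<le> 2" by simp
    then show ?thesis using r by (simp add: field_simps power2_eq_square power3_eq_cube)
  qed
  \<comment> \<open>\<open>(1 + \<tau> * x) / a\<close> has mean 1, so the tangent line integrates
    to its value at the point of contact.\<close>
  have "1 / sqrt a = P.expectation (\<lambda>x. (3 / 2 - (1 + \<tau> * x) / a / 2) / sqrt a)"
  proof -
    have "P.expectation (\<lambda>x. (3 / 2 - (1 + \<tau> * x) / a / 2) / sqrt a)
       = P.expectation (\<lambda>x. (3 / 2 - 1 / a / 2) / sqrt a - (\<tau> / a / 2 / sqrt a) * x)"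
      by (intro Bochner_Integration.integral_cong refl) (use a in \<open>simp add: field_simps\<close>)
    also have "\<dots> = (3 / 2 - 1 / a / 2) / sqrt a - (\<tau> / a / 2 / sqrt a) * (1 / lam)"
      by (subst Bochner_Integration.integral_diff) (auto simp: E P.prob_space [simplified])
    also have "\<dots> = (3 / 2 - (1 + \<tau> / lam) / a / 2) / sqrt a"
      using a assms by (simp add: field_simps)
    also have "\<dots> = 1 / sqrt a" using a by (simp add: a_def [symmetric])
    finally show ?thesis by simp
  qed
  also have "\<dots> \<le> P.expectation (\<lambda>x. 1 / sqrt (1 + \<tau> * x))"
  proof (rule integral_mono_AE)
    have "integrable ?P (\<lambda>x. (3 / 2 - 1 / a / 2) / sqrt a - (\<tau> / a / 2 / sqrt a) * x)" by simp
    also have "(\<lambda>x. (3 / 2 - 1 / a / 2) / sqrt a - (\<tau> / a / 2 / sqrt a) * x)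
       = (\<lambda>x. (3 / 2 - (1 + \<tau> * x) / a / 2) / sqrt a)" using a by (auto simp: field_simps)
    finally show "integrable ?P \<dots>" .
    show "AE x in ?P. (3 / 2 - (1 + \<tau> * x) / a / 2) / sqrt a \<le> 1 / sqrt (1 + \<tau> * x)" using pos
    proof eventually_elim
      fix x :: real assume "x > 0"
      then have p: "1 + \<tau> * x > 0" using assms by (simp add: add_pos_pos)
      have "(3 / 2 - (1 + \<tau> * x) / a / 2) / sqrt a \<le> (1 / sqrt ((1 + \<tau> * x) / a)) / sqrt a"
        using tangent[of "(1 + \<tau> * x) / a"] p a by (intro divide_right_mono) auto
      also have "\<dots> = 1 / sqrt (1 + \<tau> * x)" using a p by (simp add: real_sqrt_divide)
      finally show "(3 / 2 - (1 + \<tau> * x) / a / 2) / sqrt a \<le> 1 / sqrt (1 + \<tau> * x)" .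
    qed
  qed (rule J)
  finally have "ennreal (1 / sqrt a) \<le> ennreal (P.expectation (\<lambda>x. 1 / sqrt (1 + \<tau> * x)))"
    by (rule ennreal_leI)
  also have "\<dots> = (\<integral>\<^sup>+\<psi>. ennreal (1 / sqrt (1 + \<tau> * \<psi>)) \<partial>?P)"
  proof (rule nn_integral_eq_integral[symmetric, OF J])
    show "AE x in ?P. 0 \<le> 1 / sqrt (1 + \<tau> * x)" using pos
      by eventually_elim (use assms in \<open>simp add: add_nonneg_nonneg\<close>)
  qed
  finally show ?thesis by (simp add: a_def)
qed

text \<open>Every normal factor has mass at most 1. Equality would fail for arbitrary
  \<open>\<tau>\<close>, as the mixture is the zero function at \<open>\<tau> = 0\<close>.\<close>

lemma nn_integral_scale_mixture_le:
  assumes [measurable]: "f \<in> borel_measurable borel" and P: "prob_space (positive_law f)"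
  shows "(\<integral>\<^sup>+x. scale_mixture f \<tau> x \<partial>lborel) \<le> 1"
proof -
  interpret P: prob_space "positive_law f" by fact
  have "(\<integral>\<^sup>+x. scale_mixture f \<tau> x \<partial>lborel)
    = (\<integral>\<^sup>+\<psi>. (\<integral>\<^sup>+x. ennreal (normal_density 0 (sqrt (\<psi> * \<tau>)) x) \<partial>lborel) \<partial>positive_law f)"
    using nn_integral_scale_mixture[of f "\<lambda>_. 1" \<tau>] by simp
  also have "\<dots> \<le> (\<integral>\<^sup>+\<psi>. 1 \<partial>positive_law f)"
    by (intro nn_integral_mono nn_integral_normal_density_le_1)
  also have "\<dots> = 1" using P.emeasure_space_1 by simp
  finally show ?thesis .
qed

lemma scale_mixture_antimono:
  assumes "\<bar>x\<bar> \<le> \<bar>y\<bar>"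
  shows "scale_mixture f \<tau> y \<le> scale_mixture f \<tau> x"
proof -
  have "x\<^sup>2 \<le> y\<^sup>2" using assms by (simp add: abs_le_square_iff)
  then have "normal_density 0 s y \<le> normal_density 0 s x" for s
    unfolding normal_density_def by (intro mult_left_mono) (auto intro!: divide_right_mono)
  then show ?thesis unfolding scale_mixture_def by (intro nn_integral_mono ennreal_leI)
qed

lemma scale_mixture_minus: "scale_mixture f \<tau> (- x) = scale_mixture f \<tau> x"
  by (intro antisym scale_mixture_antimono) auto

section \<open>Deterministic lower bounds for the evidence of one observation\<close>

text \<open>Density of one observation given \<open>\<tau>\<close>, its parameter integrated out;
  the evidence given \<open>\<tau>\<close> is the product of these.\<close>

definition marginal_density :: "(real \<Rightarrow> real) \<Rightarrow> real \<Rightarrow> real \<Rightarrow> ennreal" where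
  "marginal_density f \<tau> y = (\<integral>\<^sup>+x. scale_mixture f \<tau> x * ennreal (normal_density x 1 y) \<partial>lborel)"

text \<open>The mixture is even, so averaging over \<open>x\<close> and \<open>- x\<close> replaces
  the factor \<open>exp (y * x)\<close> of the likelihood by a hyperbolic cosine, which is at least
  1. This works for every \<open>y\<close>, so no exceptional set of data has to be
  excluded.\<close>

lemma marginal_density_ge:
  assumes [measurable]: "f \<in> borel_measurable borel"
  shows "ennreal (normal_density 0 1 y) * (\<integral>\<^sup>+x. scale_mixture f \<tau> x * ennreal (exp (- (1/2) * x\<^sup>2)) \<partial>lborel)
    \<le> marginal_density f \<tau> y"
proof -
  let ?h = "scale_mixture f \<tau>"
  let ?n = "\<lambda>x. normal_density x 1 y"
  have pw: "2 * (normal_density 0 1 y * exp (- (1/2) * x\<^sup>2)) \<le> ?n x + ?n (- x)" for x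
  proof -
    have e: "normal_density z 1 y = normal_density 0 1 y * exp (- (1/2) * z\<^sup>2) * exp (y * z)" for z
    proof -
      have "- (y - z)\<^sup>2 / 2 = - y\<^sup>2 / 2 + (- (1/2) * z\<^sup>2) + y * z"
        by (simp add: power2_eq_square algebra_simps add_divide_distrib diff_divide_distrib)
      then have "exp (- (y - z)\<^sup>2 / 2) = exp (- y\<^sup>2 / 2) * exp (- (1/2) * z\<^sup>2) * exp (y * z)"
        by (simp only: exp_add)
      then show ?thesis by (simp add: normal_density_def)
    qed
    have "2 \<le> exp (y * x) + exp (y * - x)"
      using exp_ge_add_one_self[of "y * x"] exp_ge_add_one_self[of "y * - x"] by linarith
    then have "normal_density 0 1 y * exp (- (1/2) * x\<^sup>2) * 2
       \<le> normal_density 0 1 y * exp (- (1/2) * x\<^sup>2) * (exp (y * x) + exp (y * - x))"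
      by (rule mult_left_mono) auto
    then show ?thesis by (subst (1 2) e) (simp add: algebra_simps)
  qed
  have refl: "marginal_density f \<tau> y = (\<integral>\<^sup>+x. ?h x * ennreal (?n (- x)) \<partial>lborel)"
    unfolding marginal_density_def
    by (subst nn_integral_real_affine[where c = "-1" and t = 0]) (auto simp: scale_mixture_minus)
  have "2 * (ennreal (normal_density 0 1 y) * (\<integral>\<^sup>+x. ?h x * ennreal (exp (- (1/2) * x\<^sup>2)) \<partial>lborel))
      = (\<integral>\<^sup>+x. 2 * ennreal (normal_density 0 1 y) * (?h x * ennreal (exp (- (1/2) * x\<^sup>2))) \<partial>lborel)"
    by (subst nn_integral_cmult) (auto simp: mult.assoc)
  also have "\<dots> \<le> (\<integral>\<^sup>+x. ?h x * ennreal (?n x) + ?h x * ennreal (?n (- x)) \<partial>lborel)"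
  proof (rule nn_integral_mono)
    fix x
    have "2 * ennreal (normal_density 0 1 y) * (?h x * ennreal (exp (- (1/2) * x\<^sup>2)))
       = ?h x * ennreal (2 * (normal_density 0 1 y * exp (- (1/2) * x\<^sup>2)))"
      by (simp add: ennreal_mult mult_ac)
    also have "\<dots> \<le> ?h x * ennreal (?n x + ?n (- x))"
      by (intro mult_left_mono ennreal_leI pw) simp
    also have "\<dots> = ?h x * ennreal (?n x) + ?h x * ennreal (?n (- x))"
      by (simp add: ennreal_plus distrib_left)
    finally show "2 * ennreal (normal_density 0 1 y) * (?h x * ennreal (exp (- (1/2) * x\<^sup>2))) \<le> \<dots>" .
  qed
  also have "\<dots> = 2 * marginal_density f \<tau> y"
    by (subst nn_integral_add) (auto simp: mult_2 refl [symmetric] marginal_density_def [symmetric])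
  finally show ?thesis by (subst (asm) ennreal_mult_le_mult_iff) auto
qed

text \<open>Only the unit interval next to \<open>\<mu>\<close> on the side of \<open>y\<close> is
  kept. There \<open>(y - \<mu>) * (x - \<mu>)\<close> is nonnegative, so moving the mean from
  \<open>\<mu>\<close> to \<open>x\<close> costs at most \<open>exp (- (1/2))\<close>, whatever
  \<open>y\<close> is. The mixture decreases in the absolute value of its argument, hence the value
  at \<open>\<bar>\<mu>\<bar> + 1\<close>.\<close>

lemma marginal_density_ge_shifted:
  assumes [measurable]: "f \<in> borel_measurable borel"
  shows "ennreal (normal_density \<mu> 1 y * exp (- (1/2))) * scale_mixture f \<tau> (\<bar>\<mu>\<bar> + 1)
    \<le> marginal_density f \<tau> y"
proof -
  define I where "I = (if \<mu> \<le> y then {\<mu>..\<mu>+1} else {\<mu>-1..\<mu>})"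
  have [measurable]: "I \<in> sets borel" by (simp add: I_def)
  let ?c = "scale_mixture f \<tau> (\<bar>\<mu>\<bar> + 1) * ennreal (normal_density \<mu> 1 y * exp (- (1/2)))"
  have "?c = (\<integral>\<^sup>+x. ?c * indicator I x \<partial>lborel)"
    by (subst nn_integral_cmult_indicator) (auto simp: I_def)
  also have "\<dots> \<le> marginal_density f \<tau> y"
    unfolding marginal_density_def
  proof (rule nn_integral_mono)
    fix x
    show "?c * indicator I x \<le> scale_mixture f \<tau> x * ennreal (normal_density x 1 y)"
    proof (cases "x \<in> I")
      case True
      have "\<bar>x\<bar> \<le> \<bar>\<bar>\<mu>\<bar> + 1\<bar>" using True by (auto simp: I_def split: if_splits)
      moreover have "normal_density \<mu> 1 y * exp (- (1/2)) \<le> normal_density x 1 y"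
      proof -
        have "0 \<le> (y - \<mu>) * (x - \<mu>)"
          using True by (auto simp: I_def zero_le_mult_iff split: if_splits)
        moreover have "(x - \<mu>)\<^sup>2 \<le> 1"
          using True by (auto simp: I_def abs_square_le_1 split: if_splits)
        moreover have "(y - x)\<^sup>2 = (y - \<mu>)\<^sup>2 - 2 * ((y - \<mu>) * (x - \<mu>)) + (x - \<mu>)\<^sup>2"
          by (simp add: power2_eq_square algebra_simps)
        ultimately have "- (y - \<mu>)\<^sup>2 / 2 - 1 / 2 \<le> - (y - x)\<^sup>2 / 2" by simp
        then have "exp (- (y - \<mu>)\<^sup>2 / 2) * exp (- (1/2)) \<le> exp (- (y - x)\<^sup>2 / 2)"
          by (simp add: exp_add [symmetric])
        then show ?thesis by (simp add: normal_density_def divide_right_mono)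
      qed
      ultimately show ?thesis using True
        by (auto intro!: mult_mono ennreal_leI scale_mixture_antimono)
    qed simp
  qed
  finally show ?thesis by (simp add: mult.commute)
qed

section \<open>Pointwise lower bound and tail of the exponential mixture\<close>

text \<open>The joint exponent \<open>lam * \<psi> + x\<^sup>2 / (2 * \<psi> * \<tau>)\<close> is
  minimal at a \<open>\<psi>\<close> of the order of \<open>a = x / sqrt (lam * \<tau>)\<close>, and
  only the window \<open>{a..2*a}\<close> is kept. On it the first term is at most
  \<open>2 * x * w\<close> and the second at most \<open>x * w / 2\<close>, whence the 5/2.\<close>

lemma scale_mixture_exponential_ge:
  assumes "lam > 0" "\<tau> > 0" "1 \<le> sqrt (lam / \<tau>)" "1 \<le> x"
  shows "ennreal (exp (- (5/2) * x * sqrt (lam / \<tau>)) / 4) \<le> scale_mixture (exponential_density lam) \<tau> x"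
proof -
  define w where "w = sqrt (lam / \<tau>)"
  define a where "a = x * w / lam"
  \<comment> \<open>Lower bound for the joint density on the window. Multiplied by the length
    \<open>a\<close>, the factors \<open>x\<close> and \<open>lam\<close> cancel and leave
    \<open>w \<ge> 1\<close>.\<close>
  define c where "c = lam * exp (- 2 * x * w) * (exp (- x * w / 2) / (4 * x))"
  have w: "w \<ge> 1" "w\<^sup>2 = lam / \<tau>" using assms by (auto simp: w_def)
  have a: "a > 0" "a * lam = x * w" "a * \<tau> = x / w"
    using assms w by (auto simp: a_def field_simps power2_eq_square)
  have c: "c \<ge> 0" using assms by (simp add: c_def)
  have "exp (- (5/2) * x * w) / 4 \<le> w * (exp (- (5/2) * x * w) / 4)"
    using w by (simp add: mult_le_cancel_right1)
  also have "\<dots> = c * a"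
  proof -
    have "exp (- (5/2) * x * w) = exp (- 2 * x * w) * exp (- x * w / 2)"
      by (simp add: exp_add [symmetric])
    then show ?thesis using assms by (simp add: c_def a_def field_simps)
  qed
  finally have "ennreal (exp (- (5/2) * x * w) / 4) \<le> ennreal (c * a)" by (rule ennreal_leI)
  also have "\<dots> = (\<integral>\<^sup>+\<psi>. ennreal c * indicator {a..2*a} \<psi> \<partial>lborel)"
    using a c by (subst nn_integral_cmult_indicator) (auto simp: ennreal_mult)
  also have "\<dots> \<le> (\<integral>\<^sup>+\<psi>. ennreal (exponential_density lam \<psi>) * ennreal (normal_density 0 (sqrt (\<psi> * \<tau>)) x) \<partial>lborel)"
  proof (rule nn_integral_mono)
    fix \<psi>
    show "ennreal c * indicator {a..2*a} \<psi>
      \<le> ennreal (exponential_density lam \<psi>) * ennreal (normal_density 0 (sqrt (\<psi> * \<tau>)) x)"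
    proof (cases "\<psi> \<in> {a..2*a}")
      case True
      then have psi: "a \<le> \<psi>" "\<psi> \<le> 2 * a" "\<psi> > 0" using a by auto
      have "\<psi> * lam \<le> 2 * x * w" using mult_right_mono[OF psi(2), of lam] a(2) assms(1) by (simp add: mult.assoc)
      then have 1: "lam * exp (- 2 * x * w) \<le> exponential_density lam \<psi>"
        using psi assms by (simp add: exponential_density_def)
      have lo: "x / w \<le> \<psi> * \<tau>" using mult_right_mono[OF psi(1), of \<tau>] a assms by simp
      have hi: "\<psi> * \<tau> \<le> 2 * (x / w)" using mult_right_mono[OF psi(2), of \<tau>] a(3) assms(2) by (simp add: mult.assoc)
      have pos: "\<psi> * \<tau> > 0" using psi assms by simp
      have "x\<^sup>2 / (2 * (\<psi> * \<tau>)) \<le> x\<^sup>2 / (2 * (x / w))"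
        using lo assms w pos psi by (intro divide_left_mono) (auto intro!: mult_pos_pos divide_pos_pos)
      also have "\<dots> = x * w / 2" using assms w by (simp add: field_simps power2_eq_square)
      finally have e: "exp (- x * w / 2) \<le> exp (- x\<^sup>2 / (2 * (\<psi> * \<tau>)))" by simp
      \<comment> \<open>\<open>pi < 4\<close> and \<open>w \<ge> 1\<close> bound the radicand by
        \<open>16 * x\<close>, and \<open>x \<ge> 1\<close> turns this into a square.\<close>
      have "2 * pi * (\<psi> * \<tau>) \<le> 2 * 4 * (2 * x)"
      proof (rule mult_mono)
        have "x / w \<le> x / 1" using assms w by (intro divide_left_mono) auto
        then show "\<psi> * \<tau> \<le> 2 * x" using hi by simp
        show "2 * pi \<le> 2 * 4" using pi_less_4 by simp
      qed (use pos in auto)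
      also have "\<dots> \<le> (4 * x)\<^sup>2" using assms by (simp add: power2_eq_square)
      finally have s: "sqrt (2 * pi * (\<psi> * \<tau>)) \<le> 4 * x" using assms by (intro real_le_lsqrt) auto
      have "exp (- x * w / 2) / (4 * x) \<le> exp (- x\<^sup>2 / (2 * (\<psi> * \<tau>))) / sqrt (2 * pi * (\<psi> * \<tau>))"
        using e s pos assms by (intro frac_le) auto
      also have "\<dots> = normal_density 0 (sqrt (\<psi> * \<tau>)) x"
        using pos by (simp add: normal_density_def)
      finally have "c \<le> exponential_density lam \<psi> * normal_density 0 (sqrt (\<psi> * \<tau>)) x"
        unfolding c_def using assms 1 by (intro mult_mono) auto
      then have "ennreal c \<le> ennreal (exponential_density lam \<psi>) * ennreal (normal_density 0 (sqrt (\<psi> * \<tau>)) x)"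
        using assms by (subst ennreal_mult [symmetric]) (auto simp: exponential_density_nonneg intro: ennreal_leI)
      then show ?thesis using True by simp
    qed simp
  qed
  also have "\<dots> = scale_mixture (exponential_density lam) \<tau> x"
    unfolding scale_mixture_def positive_law_exponential by (rule nn_integral_density[symmetric]) auto
  finally show ?thesis by (simp add: w_def)
qed

text \<open>Chernoff's bound: the interval lies on the side of \<open>\<mu>\<close>, at distance at
  least \<open>\<bar>\<mu>\<bar> / 2\<close> from 0. The mixture is a Laplace density with rate
  \<open>sqrt (2 * lam / \<tau>)\<close>; the smaller tilt \<open>sqrt (lam / \<tau>)\<close> keeps
  the exponential moment finite, namely at most 2.\<close>

lemma scale_mixture_exponential_tail:
  assumes "lam > 0" "\<tau> > 0"
  shows "(\<integral>\<^sup>+x. scale_mixture (exponential_density lam) \<tau> x * indicator {x. \<bar>x - \<mu>\<bar> \<le> \<bar>\<mu>\<bar> / 2} x \<partial>lborel)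
    \<le> ennreal (2 * exp (- (\<bar>\<mu>\<bar> / 2) * sqrt (lam / \<tau>)))"
proof -
  let ?e = "exponential_density lam"
  define w where "w = sqrt (lam / \<tau>)"
  define b where "b = sgn \<mu> * w"
  have w: "w \<ge> 0" "w\<^sup>2 = lam / \<tau>" using assms by (auto simp: w_def)
  \<comment> \<open>Strict only for \<open>\<mu> = 0\<close>, where \<open>sgn\<close> makes the
    tilt trivial.\<close>
  have b: "b\<^sup>2 \<le> lam / \<tau>" using w assms by (auto simp: b_def sgn_if power_mult_distrib)
  have "(\<integral>\<^sup>+x. scale_mixture ?e \<tau> x * indicator {x. \<bar>x - \<mu>\<bar> \<le> \<bar>\<mu>\<bar> / 2} x \<partial>lborel)
     \<le> (\<integral>\<^sup>+x. ennreal (exp (- (\<bar>\<mu>\<bar> / 2) * w)) * (scale_mixture ?e \<tau> x * ennreal (exp (b * x))) \<partial>lborel)"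
  proof (rule nn_integral_mono)
    fix x
    have *: "indicator {x. \<bar>x - \<mu>\<bar> \<le> \<bar>\<mu>\<bar> / 2} x \<le> ennreal (exp (- (\<bar>\<mu>\<bar> / 2) * w) * exp (b * x))"
    proof (cases "\<bar>x - \<mu>\<bar> \<le> \<bar>\<mu>\<bar> / 2")
      case True
      then have "\<bar>\<mu>\<bar> / 2 \<le> sgn \<mu> * x" by (auto simp: sgn_if abs_if split: if_splits)
      then have "\<bar>\<mu>\<bar> / 2 * w \<le> sgn \<mu> * x * w" using w by (intro mult_right_mono)
      then have "1 \<le> exp (- (\<bar>\<mu>\<bar> / 2) * w) * exp (b * x)"
        by (simp add: exp_add [symmetric] b_def mult_ac)
      then show ?thesis using True by (simp add: ennreal_leI flip: ennreal_1)
    qed simp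
    show "scale_mixture ?e \<tau> x * indicator {x. \<bar>x - \<mu>\<bar> \<le> \<bar>\<mu>\<bar> / 2} x
      \<le> ennreal (exp (- (\<bar>\<mu>\<bar> / 2) * w)) * (scale_mixture ?e \<tau> x * ennreal (exp (b * x)))"
      using mult_left_mono[OF *, of "scale_mixture ?e \<tau> x"] by (simp add: ennreal_mult mult_ac)
  qed
  also have "\<dots> = ennreal (exp (- (\<bar>\<mu>\<bar> / 2) * w))
      * (\<integral>\<^sup>+\<psi>. (\<integral>\<^sup>+x. ennreal (normal_density 0 (sqrt (\<psi> * \<tau>)) x) * ennreal (exp (b * x)) \<partial>lborel) \<partial>positive_law ?e)"
    by (subst nn_integral_cmult) (auto simp: nn_integral_scale_mixture)
  also have "\<dots> \<le> ennreal (exp (- (\<bar>\<mu>\<bar> / 2) * w)) * (\<integral>\<^sup>+\<psi>. ennreal (exp (lam * \<psi> / 2)) \<partial>positive_law ?e)"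
  proof (intro mult_left_mono nn_integral_mono_AE)
    have "AE \<psi> in positive_law ?e. \<psi> > 0" by (rule AE_positive_law_pos) simp
    then show "AE \<psi> in positive_law ?e. (\<integral>\<^sup>+x. ennreal (normal_density 0 (sqrt (\<psi> * \<tau>)) x) * ennreal (exp (b * x)) \<partial>lborel)
       \<le> ennreal (exp (lam * \<psi> / 2))"
    proof eventually_elim
      fix \<psi> :: real assume psi: "\<psi> > 0"
      have "b\<^sup>2 * (\<psi> * \<tau>) \<le> lam / \<tau> * (\<psi> * \<tau>)" using b psi assms by (intro mult_right_mono) auto
      then have "b\<^sup>2 * (\<psi> * \<tau>) / 2 \<le> lam * \<psi> / 2" using assms by simp
      then show "(\<integral>\<^sup>+x. ennreal (normal_density 0 (sqrt (\<psi> * \<tau>)) x) * ennreal (exp (b * x)) \<partial>lborel)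
         \<le> ennreal (exp (lam * \<psi> / 2))"
        using psi assms by (subst nn_integral_normal_density_exp) (auto intro!: ennreal_leI)
    qed
  qed simp
  also have "(\<integral>\<^sup>+\<psi>. ennreal (exp (lam * \<psi> / 2)) \<partial>positive_law ?e)
     = (\<integral>\<^sup>+\<psi>. ennreal (?e \<psi>) * ennreal (exp (lam * \<psi> / 2)) \<partial>lborel)"
    unfolding positive_law_exponential by (rule nn_integral_density) auto
  also have "\<dots> = (\<integral>\<^sup>+\<psi>. 2 * ennreal (exponential_density (lam / 2) \<psi>) \<partial>lborel)"
  proof (rule nn_integral_cong)
    fix \<psi>
    have "?e \<psi> * exp (lam * \<psi> / 2) = 2 * exponential_density (lam / 2) \<psi>"
      by (auto simp: exponential_density_def exp_add [symmetric] mult_ac)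
    then show "ennreal (?e \<psi>) * ennreal (exp (lam * \<psi> / 2)) = 2 * ennreal (exponential_density (lam / 2) \<psi>)"
      by (simp add: ennreal_mult' flip: ennreal_mult'')
  qed
  also have "\<dots> = 2"
    using prob_space.emeasure_space_1[OF prob_space_exponential_density[of "lam / 2"]] assms
    by (subst nn_integral_cmult) (auto simp: emeasure_density)
  also have "ennreal (exp (- (\<bar>\<mu>\<bar> / 2) * w)) * 2 = ennreal (2 * exp (- (\<bar>\<mu>\<bar> / 2) * w))"
    by (simp add: ennreal_mult mult.commute)
  finally show ?thesis by (simp add: w_def)
qed

text \<open>In the bound for the ball each null coordinate contributes a random factor with
  \<open>exp (y\<^sup>2 / 4)\<close>; this is its mean under the truth.\<close>

lemma nn_integral_normal_density_exp_quarter: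
  "(\<integral>\<^sup>+y. ennreal (normal_density 0 1 y) * ennreal (exp (y\<^sup>2 / 4)) \<partial>lborel) = ennreal (sqrt 2)"
  using nn_integral_normal_density_exp_square[of 1 "- (1/4)"] by (simp add: real_sqrt_divide)

section \<open>Posterior mass of a small ball\<close>

text \<open>The cross term satisfies \<open>x * y \<le> y\<^sup>2 / 4 + x\<^sup>2\<close>, which
  separates parameter and observation. With the \<open>- x\<^sup>2 / 2\<close> of the normal
  exponent this leaves \<open>t - 1/2\<close>, and \<open>exp (y\<^sup>2 / 4)\<close> still has a
  finite standard normal mean. The 1 is the coordinate's share of \<open>card S\<close> in the
  Chernoff bound.\<close>

lemma normal_density_le_tilted:
  "normal_density x 1 y * exp (1 - t * x\<^sup>2)
    \<le> exp 1 * exp (y\<^sup>2 / 4) * normal_density 0 1 y * exp (- (t - 1/2) * x\<^sup>2)"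
proof -
  have "0 \<le> (y / 2 - x)\<^sup>2" by simp
  then have "- (y - x)\<^sup>2 / 2 + (1 - t * x\<^sup>2) \<le> 1 + y\<^sup>2 / 4 + - y\<^sup>2 / 2 + - (t - 1/2) * x\<^sup>2"
    by (simp add: power2_eq_square algebra_simps add_divide_distrib diff_divide_distrib)
  then have "exp (- (y - x)\<^sup>2 / 2 + (1 - t * x\<^sup>2)) \<le> exp (1 + y\<^sup>2 / 4 + - y\<^sup>2 / 2 + - (t - 1/2) * x\<^sup>2)"
    by (rule exp_le_cancel_iff [THEN iffD2])
  then have "exp (- (y - x)\<^sup>2 / 2) * exp (1 - t * x\<^sup>2)
     \<le> exp 1 * exp (y\<^sup>2 / 4) * exp (- y\<^sup>2 / 2) * exp (- (t - 1/2) * x\<^sup>2)"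
    by (simp only: exp_add)
  then show ?thesis by (simp add: normal_density_def divide_right_mono mult_ac)
qed

text \<open>
  The Chernoff bound \<open>indicator \<le> exp (card S - t * (\<Sum>j\<in>S. (\<theta> j)\<^sup>2))\<close> makes the integral over the
  small ball factorize.
\<close>

lemma nn_integral_ball_le:
  fixes y :: "'i \<Rightarrow> real" and lam t :: real and B :: "('i \<Rightarrow> real) set"
  defines "f \<equiv> exponential_density lam"
  assumes lam: "lam > 0" and tau: "\<tau> > 0" and I: "finite I" "j0 \<in> I"
    and B: "\<And>\<theta>. \<theta> \<in> B \<Longrightarrow> t * (\<Sum>j\<in>I - {j0}. (\<theta> j)\<^sup>2) \<le> card (I - {j0})"
    and t: "t > 1/2" and \<kappa>: "(2 * lam + 1) / sqrt (2 * (t - 1/2) * \<tau>) \<le> \<kappa> / sqrt (1 + \<tau> / lam)"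
  shows "(\<integral>\<^sup>+\<theta>. (\<Prod>j\<in>I. scale_mixture f \<tau> (\<theta> j)) * ((\<Prod>j\<in>I. ennreal (normal_density (\<theta> j) 1 (y j))) * indicator B \<theta>)
        \<partial>PiM I (\<lambda>_. lborel))
    \<le> (\<Prod>j\<in>I - {j0}. ennreal (exp 1 * \<kappa> * exp ((y j)\<^sup>2 / 4))) * (\<Prod>j\<in>I. marginal_density f \<tau> (y j))"
proof -
  let ?S = "I - {j0}"
  have f [measurable]: "f \<in> borel_measurable borel" by (simp add: f_def)
  have I': "I = insert j0 ?S" "j0 \<notin> ?S" "finite ?S" using I by auto
  have prod_I: "prod F I = F j0 * prod F ?S" for F :: "'i \<Rightarrow> ennreal"
    by (subst I'(1), subst prod.insert) (use I' in auto)
  \<comment> \<open>A majorant that is a product over coordinates: the signal keeps its factor and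
    will integrate to its marginal density, the null coordinates carry the tilted bound.\<close>
  define w where "w j x = (if j = j0 then scale_mixture f \<tau> x * ennreal (normal_density x 1 (y j))
     else ennreal (exp 1 * exp ((y j)\<^sup>2 / 4)) * (ennreal (normal_density 0 1 (y j)) *
            (scale_mixture f \<tau> x * ennreal (exp (- (t - 1/2) * x\<^sup>2)))))" for j x
  have [measurable]: "w j \<in> borel_measurable borel" for j
    unfolding w_def by measurable
  have "(\<Prod>j\<in>I. scale_mixture f \<tau> (\<theta> j)) * ((\<Prod>j\<in>I. ennreal (normal_density (\<theta> j) 1 (y j))) * indicator B \<theta>)
     \<le> (\<Prod>j\<in>I. w j (\<theta> j))" for \<theta>
  proof (cases "\<theta> \<in> B")
    case True
    have "1 \<le> exp (\<Sum>j\<in>?S. 1 - t * (\<theta> j)\<^sup>2)"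
      using B[OF True] by (simp add: sum_subtractf sum_distrib_left)
    also have "\<dots> = (\<Prod>j\<in>?S. exp (1 - t * (\<theta> j)\<^sup>2))" by (rule exp_sum) (use I in simp)
    finally have "1 \<le> (\<Prod>j\<in>?S. ennreal (exp (1 - t * (\<theta> j)\<^sup>2)))"
      by (subst prod_ennreal) (simp_all add: ennreal_ge_1)
    then have "(\<Prod>j\<in>I. scale_mixture f \<tau> (\<theta> j)) * ((\<Prod>j\<in>I. ennreal (normal_density (\<theta> j) 1 (y j))) * 1)
      \<le> (\<Prod>j\<in>I. scale_mixture f \<tau> (\<theta> j)) * ((\<Prod>j\<in>I. ennreal (normal_density (\<theta> j) 1 (y j)))
          * (\<Prod>j\<in>?S. ennreal (exp (1 - t * (\<theta> j)\<^sup>2))))"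
      by (intro mult_left_mono) auto
    also have "\<dots> = scale_mixture f \<tau> (\<theta> j0) * ennreal (normal_density (\<theta> j0) 1 (y j0)) *
      (\<Prod>j\<in>?S. scale_mixture f \<tau> (\<theta> j) * (ennreal (normal_density (\<theta> j) 1 (y j)) * ennreal (exp (1 - t * (\<theta> j)\<^sup>2))))"
      by (simp add: prod_I prod.distrib mult_ac)
    also have "\<dots> \<le> w j0 (\<theta> j0) * (\<Prod>j\<in>?S. w j (\<theta> j))"
    proof (intro mult_mono prod_mono_ennreal)
      fix j assume "j \<in> ?S"
      have "ennreal (normal_density (\<theta> j) 1 (y j)) * ennreal (exp (1 - t * (\<theta> j)\<^sup>2))
         \<le> ennreal (exp 1 * exp ((y j)\<^sup>2 / 4)) * (ennreal (normal_density 0 1 (y j)) * ennreal (exp (- (t - 1/2) * (\<theta> j)\<^sup>2)))"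
        using ennreal_leI[OF normal_density_le_tilted[of "\<theta> j" "y j" t]]
        by (simp only: ennreal_mult'' exp_ge_zero normal_density_nonneg mult_nonneg_nonneg mult.assoc)
      then have "scale_mixture f \<tau> (\<theta> j) * (ennreal (normal_density (\<theta> j) 1 (y j)) * ennreal (exp (1 - t * (\<theta> j)\<^sup>2)))
         \<le> scale_mixture f \<tau> (\<theta> j) * (ennreal (exp 1 * exp ((y j)\<^sup>2 / 4)) * (ennreal (normal_density 0 1 (y j)) * ennreal (exp (- (t - 1/2) * (\<theta> j)\<^sup>2))))"
        by (rule mult_left_mono) simp
      also have "\<dots> = w j (\<theta> j)" using \<open>j \<in> ?S\<close> unfolding w_def by (simp only: if_False mult_ac) auto
      finally show "scale_mixture f \<tau> (\<theta> j) * (ennreal (normal_density (\<theta> j) 1 (y j)) * ennreal (exp (1 - t * (\<theta> j)\<^sup>2))) \<le> w j (\<theta> j)" .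
    qed (auto simp: w_def)
    also have "\<dots> = (\<Prod>j\<in>I. w j (\<theta> j))" by (simp add: prod_I)
    finally show ?thesis using True by simp
  qed simp
  then have "(\<integral>\<^sup>+\<theta>. (\<Prod>j\<in>I. scale_mixture f \<tau> (\<theta> j)) * ((\<Prod>j\<in>I. ennreal (normal_density (\<theta> j) 1 (y j))) * indicator B \<theta>)
        \<partial>PiM I (\<lambda>_. lborel)) \<le> (\<integral>\<^sup>+\<theta>. (\<Prod>j\<in>I. w j (\<theta> j)) \<partial>PiM I (\<lambda>_. lborel))"
    by (intro nn_integral_mono)
  also have "\<dots> = (\<Prod>j\<in>I. integral\<^sup>N lborel (w j))"
    by (rule lborel_prod.product_nn_integral_prod) (use I in auto)
  also have "\<dots> = marginal_density f \<tau> (y j0) * (\<Prod>j\<in>?S. integral\<^sup>N lborel (w j))"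
    unfolding prod_I marginal_density_def
    by (intro arg_cong2[where f = "(*)"] nn_integral_cong refl) (simp add: w_def)
  also have "\<dots> \<le> marginal_density f \<tau> (y j0) * (\<Prod>j\<in>?S. ennreal (exp 1 * \<kappa> * exp ((y j)\<^sup>2 / 4)) * marginal_density f \<tau> (y j))"
  proof (intro mult_left_mono prod_mono_ennreal)
    fix j assume j: "j \<in> ?S"
    have k0: "\<kappa> \<ge> 0"
    proof (rule ccontr)
      assume "\<not> 0 \<le> \<kappa>"
      then have "\<kappa> / sqrt (1 + \<tau> / lam) < 0" using lam tau by (intro divide_neg_pos) (auto intro!: add_pos_pos)
      moreover have "0 \<le> (2 * lam + 1) / sqrt (2 * (t - 1/2) * \<tau>)" using lam tau t by simp
      ultimately show False using \<kappa> by linarith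
    qed
    \<comment> \<open>The hypothesis on \<open>\<kappa>\<close> compares the upper bound for the
      tilted integral with Jensen's lower bound for the integral in
      \<open>marginal_density_ge\<close>. So each null coordinate is bounded by a multiple of its
      own evidence.\<close>
    have "(\<integral>\<^sup>+x. scale_mixture f \<tau> x * ennreal (exp (- (t - 1/2) * x\<^sup>2)) \<partial>lborel)
        \<le> ennreal ((2 * lam + 1) / sqrt (2 * (t - 1/2) * \<tau>))"
      using lam tau t unfolding f_def
      by (subst nn_integral_scale_mixture_exp_square)
         (auto intro!: nn_integral_inverse_sqrt_exponential_le mult_pos_pos)
    also have "\<dots> \<le> ennreal (\<kappa> / sqrt (1 + \<tau> / lam))" using \<kappa> by (rule ennreal_leI)
    also have "\<dots> = ennreal \<kappa> * ennreal (1 / sqrt (1 + \<tau> / lam))"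
      using k0 lam tau by (subst ennreal_mult [symmetric]) auto
    also have "\<dots> \<le> ennreal \<kappa> * (\<integral>\<^sup>+x. scale_mixture f \<tau> x * ennreal (exp (- (1/2) * x\<^sup>2)) \<partial>lborel)"
      using nn_integral_inverse_sqrt_exponential_ge[OF lam tau] lam tau unfolding f_def
      by (subst nn_integral_scale_mixture_exp_square) (auto intro!: mult_left_mono)
    finally have "ennreal (normal_density 0 1 (y j)) * (\<integral>\<^sup>+x. scale_mixture f \<tau> x * ennreal (exp (- (t - 1/2) * x\<^sup>2)) \<partial>lborel)
       \<le> ennreal (normal_density 0 1 (y j)) * (ennreal \<kappa> * (\<integral>\<^sup>+x. scale_mixture f \<tau> x * ennreal (exp (- (1/2) * x\<^sup>2)) \<partial>lborel))"
      by (rule mult_left_mono) simp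
    also have "\<dots> = ennreal \<kappa> * (ennreal (normal_density 0 1 (y j)) * (\<integral>\<^sup>+x. scale_mixture f \<tau> x * ennreal (exp (- (1/2) * x\<^sup>2)) \<partial>lborel))"
      by (simp only: mult_ac)
    also have "\<dots> \<le> ennreal \<kappa> * marginal_density f \<tau> (y j)"
      by (intro mult_left_mono marginal_density_ge f) simp
    finally have "ennreal (exp 1 * exp ((y j)\<^sup>2 / 4)) * (ennreal (normal_density 0 1 (y j)) * (\<integral>\<^sup>+x. scale_mixture f \<tau> x * ennreal (exp (- (t - 1/2) * x\<^sup>2)) \<partial>lborel))
       \<le> ennreal (exp 1 * exp ((y j)\<^sup>2 / 4)) * (ennreal \<kappa> * marginal_density f \<tau> (y j))"
      by (rule mult_left_mono) simp
    also have "\<dots> = ennreal (exp 1 * \<kappa> * exp ((y j)\<^sup>2 / 4)) * marginal_density f \<tau> (y j)"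
    proof -
      have "ennreal (exp 1 * \<kappa> * exp ((y j)\<^sup>2 / 4)) = ennreal (exp 1 * exp ((y j)\<^sup>2 / 4)) * ennreal \<kappa>"
        using k0 by (subst ennreal_mult [symmetric]) (auto simp: mult_ac)
      then show ?thesis by (simp only: mult.assoc)
    qed
    finally have "ennreal (exp 1 * exp ((y j)\<^sup>2 / 4)) * (ennreal (normal_density 0 1 (y j)) * (\<integral>\<^sup>+x. scale_mixture f \<tau> x * ennreal (exp (- (t - 1/2) * x\<^sup>2)) \<partial>lborel))
       \<le> ennreal (exp 1 * \<kappa> * exp ((y j)\<^sup>2 / 4)) * marginal_density f \<tau> (y j)" .
    moreover have "integral\<^sup>N lborel (w j) = (\<integral>\<^sup>+x. ennreal (exp 1 * exp ((y j)\<^sup>2 / 4)) * (ennreal (normal_density 0 1 (y j)) *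
            (scale_mixture f \<tau> x * ennreal (exp (- (t - 1/2) * x\<^sup>2)))) \<partial>lborel)"
      using j by (intro nn_integral_cong) (simp add: w_def)
    ultimately show "integral\<^sup>N lborel (w j) \<le> ennreal (exp 1 * \<kappa> * exp ((y j)\<^sup>2 / 4)) * marginal_density f \<tau> (y j)"
      by (simp add: nn_integral_cmult)
  qed simp
  also have "\<dots> = (\<Prod>j\<in>?S. ennreal (exp 1 * \<kappa> * exp ((y j)\<^sup>2 / 4))) * (\<Prod>j\<in>I. marginal_density f \<tau> (y j))"
    by (simp add: prod_I prod.distrib mult_ac)
  finally show ?thesis .
qed

text \<open>Null coordinates are handled by symmetry and Jensen, the signal by the unit interval
  next to \<open>\<theta>\<^sub>0 j0\<close> and the pointwise bound for the mixture. To be uniform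
  over \<open>a \<le> \<tau> \<le> 2 * a\<close>, the null factor is taken at \<open>2 * a\<close>
  and the signal factor at \<open>a\<close>; \<open>2 * a \<le> lam\<close> gives
  \<open>1 \<le> sqrt (lam / \<tau>)\<close>.\<close>

lemma prod_marginal_density_ge:
  fixes y :: "'i \<Rightarrow> real" and lam :: real
  defines "f \<equiv> exponential_density lam"
  assumes lam: "lam > 0" and a: "0 < a" "a \<le> \<tau>" "\<tau> \<le> 2 * a" "2 * a \<le> lam" and I: "finite I" "j0 \<in> I"
    and null: "\<And>j. j \<in> I - {j0} \<Longrightarrow> \<theta>\<^sub>0 j = 0"
  shows "ennreal ((1 / sqrt (1 + 2 * a / lam)) ^ card (I - {j0}) *
           (exp (- (1/2)) * (exp (- (5/2) * (\<bar>\<theta>\<^sub>0 j0\<bar> + 1) * sqrt (lam / a)) / 4)))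
      * (\<Prod>j\<in>I. ennreal (normal_density (\<theta>\<^sub>0 j) 1 (y j)))
    \<le> (\<Prod>j\<in>I. marginal_density f \<tau> (y j))"
proof -
  let ?S = "I - {j0}" let ?\<mu> = "\<theta>\<^sub>0 j0"
  have f [measurable]: "f \<in> borel_measurable borel" by (simp add: f_def)
  have I': "I = insert j0 ?S" "j0 \<notin> ?S" "finite ?S" using I by auto
  have prod_I: "prod F I = F j0 * prod F ?S" for F :: "'i \<Rightarrow> ennreal"
    by (subst I'(1), subst prod.insert) (use I' in auto)
  have tau: "\<tau> > 0" using a by simp
  let ?r = "1 / sqrt (1 + 2 * a / lam)"
  let ?e = "exp (- (1/2)) * (exp (- (5/2) * (\<bar>?\<mu>\<bar> + 1) * sqrt (lam / a)) / 4)"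
  have S: "ennreal ?r * ennreal (normal_density 0 1 (y j)) \<le> marginal_density f \<tau> (y j)" for j
  proof -
    have "?r \<le> 1 / sqrt (1 + \<tau> / lam)"
      using a tau lam by (intro divide_left_mono) (auto intro!: add_pos_pos mult_pos_pos divide_right_mono)
    then have "ennreal ?r \<le> ennreal (1 / sqrt (1 + \<tau> / lam))" by (rule ennreal_leI)
    also have "\<dots> \<le> (\<integral>\<^sup>+x. scale_mixture f \<tau> x * ennreal (exp (- (1/2) * x\<^sup>2)) \<partial>lborel)"
      using nn_integral_inverse_sqrt_exponential_ge[OF lam tau] lam tau unfolding f_def
      by (subst nn_integral_scale_mixture_exp_square) auto
    finally have "ennreal (normal_density 0 1 (y j)) * ennreal ?r
       \<le> ennreal (normal_density 0 1 (y j)) * (\<integral>\<^sup>+x. scale_mixture f \<tau> x * ennreal (exp (- (1/2) * x\<^sup>2)) \<partial>lborel)"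
      by (rule mult_left_mono) simp
    also have "\<dots> \<le> marginal_density f \<tau> (y j)" by (rule marginal_density_ge) (rule f)
    finally show ?thesis by (simp only: mult.commute)
  qed
  have J: "ennreal ?e * ennreal (normal_density ?\<mu> 1 (y j0)) \<le> marginal_density f \<tau> (y j0)"
  proof -
    have "1 \<le> lam / \<tau>" using a tau by simp
    then have "1 \<le> sqrt (lam / \<tau>)" by simp
    then have "ennreal (exp (- (5/2) * (\<bar>?\<mu>\<bar> + 1) * sqrt (lam / \<tau>)) / 4) \<le> scale_mixture f \<tau> (\<bar>?\<mu>\<bar> + 1)"
      unfolding f_def using lam tau by (intro scale_mixture_exponential_ge) auto
    moreover have "exp (- (5/2) * (\<bar>?\<mu>\<bar> + 1) * sqrt (lam / a)) / 4 \<le> exp (- (5/2) * (\<bar>?\<mu>\<bar> + 1) * sqrt (lam / \<tau>)) / 4"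
    proof -
      have "sqrt (lam / \<tau>) \<le> sqrt (lam / a)" using a lam tau by (simp add: divide_left_mono)
      then have "(5/2) * (\<bar>?\<mu>\<bar> + 1) * sqrt (lam / \<tau>) \<le> (5/2) * (\<bar>?\<mu>\<bar> + 1) * sqrt (lam / a)"
        by (intro mult_left_mono) auto
      then show ?thesis by simp
    qed
    ultimately have "ennreal (exp (- (5/2) * (\<bar>?\<mu>\<bar> + 1) * sqrt (lam / a)) / 4) \<le> scale_mixture f \<tau> (\<bar>?\<mu>\<bar> + 1)"
      by (meson ennreal_leI order_trans)
    then have "ennreal (normal_density ?\<mu> 1 (y j0) * exp (- (1/2))) * ennreal (exp (- (5/2) * (\<bar>?\<mu>\<bar> + 1) * sqrt (lam / a)) / 4)
      \<le> ennreal (normal_density ?\<mu> 1 (y j0) * exp (- (1/2))) * scale_mixture f \<tau> (\<bar>?\<mu>\<bar> + 1)"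
      by (rule mult_left_mono) simp
    also have "\<dots> \<le> marginal_density f \<tau> (y j0)" by (rule marginal_density_ge_shifted) (rule f)
    also have "ennreal (normal_density ?\<mu> 1 (y j0) * exp (- (1/2))) * ennreal (exp (- (5/2) * (\<bar>?\<mu>\<bar> + 1) * sqrt (lam / a)) / 4)
       = ennreal ?e * ennreal (normal_density ?\<mu> 1 (y j0))"
      by (subst (1 2) ennreal_mult [symmetric]) (auto simp: mult_ac)
    finally show ?thesis .
  qed
  have "ennreal (r ^ card ?S * e) = ennreal e * (\<Prod>j\<in>?S. ennreal r)" if "r \<ge> 0" "e \<ge> 0" for r e
    using that by (simp add: ennreal_mult ennreal_power mult.commute)
  from this[of ?r ?e] have "ennreal (?r ^ card ?S * ?e) = ennreal ?e * (\<Prod>j\<in>?S. ennreal ?r)"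
    using lam a by simp
  then have "ennreal (?r ^ card ?S * ?e) * (\<Prod>j\<in>I. ennreal (normal_density (\<theta>\<^sub>0 j) 1 (y j)))
     = (ennreal ?e * ennreal (normal_density ?\<mu> 1 (y j0))) * ((\<Prod>j\<in>?S. ennreal ?r) * (\<Prod>j\<in>?S. ennreal (normal_density (\<theta>\<^sub>0 j) 1 (y j))))"
    by (simp only: prod_I mult_ac)
  also have "\<dots> = (ennreal ?e * ennreal (normal_density ?\<mu> 1 (y j0))) * (\<Prod>j\<in>?S. ennreal ?r * ennreal (normal_density 0 1 (y j)))"
    using null by (simp add: prod.distrib)
  also have "\<dots> \<le> marginal_density f \<tau> (y j0) * (\<Prod>j\<in>?S. marginal_density f \<tau> (y j))"
    by (intro mult_mono J prod_mono_ennreal S) auto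
  also have "\<dots> = (\<Prod>j\<in>I. marginal_density f \<tau> (y j))" by (simp only: prod_I)
  finally show ?thesis .
qed

text \<open>
  First summand: global scales \<open>\<tau> \<ge> \<tau>\<^sub>1\<close>, compared with the evidence separately for each \<open>\<tau>\<close>. Second
  summand: prior mass of the ball with \<open>\<tau> < \<tau>\<^sub>1\<close>, divided by a lower bound for the likelihood ratio
  of the evidence to the truth that comes from \<open>\<tau> \<in> {a..2*a}\<close>.
\<close>

lemma integral_posterior_le:
  fixes \<theta>\<^sub>0 :: "nat \<Rightarrow> real" and M a \<tau>\<^sub>1 \<kappa> t \<rho> lam :: real and g :: "real \<Rightarrow> real" and n j0 :: nat
  defines "f \<equiv> exponential_density lam"
    and "B \<equiv> {\<theta> \<in> {1..n} \<rightarrow>\<^sub>E UNIV. L2_set (\<lambda>j. \<theta> j - \<theta>\<^sub>0 j) {1..n} \<le> \<rho>}"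
    and "\<mu> \<equiv> \<theta>\<^sub>0 j0"
  defines "d \<equiv> (1 / sqrt (1 + 2 * a / lam)) ^ (n - 1) *
      (exp (- (1/2)) * (exp (- (5/2) * (\<bar>\<mu>\<bar> + 1) * sqrt (lam / a)) / 4))"
  assumes lam: "lam > 0" and g [measurable]: "g \<in> borel_measurable borel"
    and g1: "(\<integral>\<^sup>+t\<in>{0<..}. ennreal (g t) \<partial>lborel) = 1"
    and M: "M > 0" "\<And>\<tau>. 0 < \<tau> \<Longrightarrow> \<tau> < 1 \<Longrightarrow> g \<tau> > 1 / M"
    and j0: "j0 \<in> {1..n}" and null: "\<And>j. j \<in> {1..n} - {j0} \<Longrightarrow> \<theta>\<^sub>0 j = 0"
    and \<rho>: "\<rho> \<le> \<bar>\<mu>\<bar> / 2" and t: "t > 1/2" "t * \<rho>\<^sup>2 \<le> real (n - 1)"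
    and \<tau>\<^sub>1: "\<tau>\<^sub>1 > 0" and \<kappa>: "\<kappa> \<ge> 0"
      "\<And>\<tau>. \<tau>\<^sub>1 \<le> \<tau> \<Longrightarrow> (2 * lam + 1) / sqrt (2 * (t - 1/2) * \<tau>) \<le> \<kappa> / sqrt (1 + \<tau> / lam)"
    and a: "0 < a" "2 * a < 1" "2 * a \<le> lam"
  shows "(\<integral>y. measure (posterior n (global_local_prior f g n) y) B \<partial>normal_means n \<theta>\<^sub>0)
    \<le> (exp 1 * \<kappa> * sqrt 2) ^ (n - 1) + 2 * exp (- (\<bar>\<mu>\<bar> / 2) * sqrt (lam / \<tau>\<^sub>1)) / (a / M * d)"
proof -
  define I where "I = {1..n}"
  define Q where "Q = PiM I (\<lambda>_. lborel :: real measure)"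
  define G where "G = positive_law g"
  define \<pi> where "\<pi> = global_local_prior f g n"
  define K where "K \<tau> \<theta> = (\<Prod>j\<in>I. scale_mixture f \<tau> (\<theta> j))" for \<tau> and \<theta> :: "nat \<Rightarrow> real"
  define L where "L \<theta> y = (\<Prod>j\<in>I. ennreal (normal_density (\<theta> j) 1 (y j)))" for \<theta> y :: "nat \<Rightarrow> real"
  define p where "p y = (\<Prod>j\<in>I. normal_density (\<theta>\<^sub>0 j) 1 (y j))" for y
  let ?S = "I - {j0}"
  have I [simp, intro]: "finite I" "j0 \<in> I" and cS: "card ?S = n - 1" using j0 by (auto simp: I_def)
  have I': "I = insert j0 ?S" "j0 \<notin> ?S" "finite ?S" using I by auto
  have prod_I: "prod F I = F j0 * prod F ?S" for F :: "nat \<Rightarrow> ennreal"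
    by (subst I'(1), subst prod.insert) (use I' in auto)
  have f [measurable]: "f \<in> borel_measurable borel" by (simp add: f_def)
  have prob_f: "prob_space (positive_law f)" unfolding f_def by (rule prob_space_positive_law_exponential) fact
  have [measurable_cong]: "sets G = sets borel" by (simp add: G_def sets_positive_law)
  interpret G: sigma_finite_measure G unfolding G_def by (rule sigma_finite_positive_law) fact
  interpret Q: sigma_finite_measure Q unfolding Q_def by (rule lborel_prod.sigma_finite) simp
  interpret QG: pair_sigma_finite Q G ..
  interpret QQ: pair_sigma_finite Q Q ..
  have G1: "emeasure G UNIV = 1"
    using g1 by (simp add: G_def positive_law_def emeasure_density)
  have G_pos: "AE \<tau> in G. \<tau> > 0" unfolding G_def by (rule AE_positive_law_pos) fact
  have comp: "(\<lambda>x. F x j) \<in> borel_measurable N" if "F \<in> measurable N Q" "j \<in> I" for F j and N :: "'x measure"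
    using measurable_compose[OF that(1)[unfolded Q_def] measurable_component_singleton[OF that(2)]] by simp
  have mK: "(\<lambda>x. K (T x) (F x)) \<in> borel_measurable N" if "T \<in> borel_measurable N" "F \<in> measurable N Q" for T F and N :: "'x measure"
    unfolding K_def by (intro borel_measurable_prod_ennreal measurable_scale_mixture[OF f that(1)] comp[OF that(2)])
  have mL: "(\<lambda>x. L (F x) (Y x)) \<in> borel_measurable N" if "F \<in> measurable N Q" "Y \<in> measurable N Q" for F Y and N :: "'x measure"
    unfolding L_def
    by (intro borel_measurable_prod_ennreal measurable_compose[OF _ measurable_ennreal]
        measurable_normal_density2 comp[OF that(1)] comp[OF that(2)] measurable_const) simp_all
  note [measurable (raw)] = mK mL
  have coord: "(\<lambda>x. x j) \<in> borel_measurable Q" if "j \<in> I" for j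
    using measurable_component_singleton[OF that, of "\<lambda>_. lborel :: real measure"] by (simp add: Q_def)
  have sets_Q: "sets Q = sets (PiM {1..n} (\<lambda>_. borel))" unfolding Q_def I_def by (rule sets_PiM_lborel)
  have space_Q: "space Q = I \<rightarrow>\<^sub>E UNIV" by (simp add: Q_def space_PiM)
  have B_alt: "B = {\<theta> \<in> space Q. L2_set (\<lambda>j. \<theta> j - \<theta>\<^sub>0 j) I \<le> \<rho>}"
    by (simp add: B_def space_Q I_def)
  have B [measurable]: "B \<in> sets Q"
  proof -
    have [measurable]: "(\<lambda>\<theta>. \<Sum>j\<in>I. (\<theta> j - \<theta>\<^sub>0 j)\<^sup>2) \<in> borel_measurable Q"
      by (intro borel_measurable_sum borel_measurable_power borel_measurable_diff coord) auto
    show ?thesis unfolding B_alt L2_set_def by measurable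
  qed
  have sets_\<pi>: "sets \<pi> = sets Q"
    unfolding \<pi>_def sets_Q by (rule sets_global_local_prior[OF f prob_f])
  \<comment> \<open>Off \<open>j0\<close> the truth is 0, so the squares of the null coordinates add
    up to at most \<open>\<rho>\<^sup>2\<close>; this is the premise of the Chernoff bound.\<close>
  have B_sum: "t * (\<Sum>j\<in>?S. (\<theta> j)\<^sup>2) \<le> real (card ?S)" if "\<theta> \<in> B" for \<theta>
  proof -
    have "(\<Sum>j\<in>?S. (\<theta> j)\<^sup>2) = (\<Sum>j\<in>?S. (\<theta> j - \<theta>\<^sub>0 j)\<^sup>2)"
      using null by (intro sum.cong) (auto simp: I_def)
    also have "\<dots> \<le> (\<Sum>j\<in>I. (\<theta> j - \<theta>\<^sub>0 j)\<^sup>2)" by (intro sum_mono2) auto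
    also have "\<dots> = (L2_set (\<lambda>j. \<theta> j - \<theta>\<^sub>0 j) I)\<^sup>2" by (simp add: L2_set_def sum_nonneg)
    also have "\<dots> \<le> \<rho>\<^sup>2" using that by (intro power_mono) (auto simp: B_alt)
    finally have "t * (\<Sum>j\<in>?S. (\<theta> j)\<^sup>2) \<le> t * \<rho>\<^sup>2" using t by (intro mult_left_mono) auto
    then show ?thesis unfolding cS using t(2) by linarith
  qed
  \<comment> \<open>One coordinate of the error is dominated by its norm, so the ball keeps
    \<open>\<theta> j0\<close> at distance at least \<open>\<bar>\<mu>\<bar> / 2\<close> from
    0.\<close>
  have B_j0: "\<bar>\<theta> j0 - \<mu>\<bar> \<le> \<bar>\<mu>\<bar> / 2" if "\<theta> \<in> B" for \<theta>
  proof -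
    have "\<bar>\<theta> j0 - \<mu>\<bar> \<le> L2_set (\<lambda>j. \<theta> j - \<theta>\<^sub>0 j) I"
      using member_le_L2_set[of I j0 "\<lambda>j. \<bar>\<theta> j - \<theta>\<^sub>0 j\<bar>"] by (simp add: \<mu>_def L2_set_def)
    also have "\<dots> \<le> \<rho>" using that by (simp add: B_alt)
    finally show ?thesis using \<rho> by simp
  qed
  have prior: "(\<integral>\<^sup>+\<theta>. F \<theta> \<partial>\<pi>) = (\<integral>\<^sup>+\<tau>. (\<integral>\<^sup>+\<theta>. K \<tau> \<theta> * F \<theta> \<partial>Q) \<partial>G)" if "F \<in> borel_measurable Q" for F
    unfolding \<pi>_def K_def Q_def G_def I_def
    by (rule nn_integral_global_local_prior[OF f prob_f])
       (use that in \<open>simp only: measurable_cong_sets[OF sets_Q refl]\<close>)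
  \<comment> \<open>\<open>Z\<close> is the evidence; \<open>W A\<close> is the mass, before
    normalization, of the ball with global scales in \<open>A\<close>; \<open>\<delta>\<close> is
    the random factor from the null coordinates.\<close>
  define Z where "Z y = (\<integral>\<^sup>+\<theta>. L \<theta> y \<partial>\<pi>)" for y
  define W where "W A y = (\<integral>\<^sup>+\<tau>. (\<integral>\<^sup>+\<theta>. K \<tau> \<theta> * (L \<theta> y * indicator B \<theta>) \<partial>Q) * indicator A \<tau> \<partial>G)" for A y
  define \<delta> where "\<delta> y = (\<Prod>j\<in>?S. ennreal (exp 1 * \<kappa> * exp ((y j)\<^sup>2 / 4)))" for y :: "nat \<Rightarrow> real"
  have post: "emeasure (posterior n \<pi> y) B = (W {..<\<tau>\<^sub>1} y + W {\<tau>\<^sub>1..} y) / Z y" if y [measurable]: "y \<in> space Q" for y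
  proof -
    have [measurable]: "(\<lambda>\<theta>. L \<theta> y) \<in> borel_measurable \<pi>"
      by (simp only: measurable_cong_sets[OF sets_\<pi> refl]) measurable
    have lik: "ennreal (likelihood n \<theta> y) = L \<theta> y" for \<theta>
      by (simp add: likelihood_def L_def I_def prod_ennreal)
    have "emeasure (posterior n \<pi> y) B = (\<integral>\<^sup>+\<theta>. L \<theta> y / Z y * indicator B \<theta> \<partial>\<pi>)"
      unfolding posterior_def lik Z_def [symmetric]
      using B by (intro emeasure_density) (auto simp: sets_\<pi>)
    also have "\<dots> = (\<integral>\<^sup>+\<theta>. (L \<theta> y * indicator B \<theta>) / Z y \<partial>\<pi>)"
      by (intro nn_integral_cong) (simp add: divide_ennreal_def mult_ac)
    also have "\<dots> = (\<integral>\<^sup>+\<theta>. L \<theta> y * indicator B \<theta> \<partial>\<pi>) / Z y"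
      by (rule nn_integral_divide, subst measurable_cong_sets[OF sets_\<pi> refl]) measurable
    also have "(\<integral>\<^sup>+\<theta>. L \<theta> y * indicator B \<theta> \<partial>\<pi>) = (\<integral>\<^sup>+\<tau>. (\<integral>\<^sup>+\<theta>. K \<tau> \<theta> * (L \<theta> y * indicator B \<theta>) \<partial>Q) \<partial>G)"
      by (rule prior) measurable
    also have "\<dots> = (\<integral>\<^sup>+\<tau>. (\<integral>\<^sup>+\<theta>. K \<tau> \<theta> * (L \<theta> y * indicator B \<theta>) \<partial>Q) * indicator {..<\<tau>\<^sub>1} \<tau>
         + (\<integral>\<^sup>+\<theta>. K \<tau> \<theta> * (L \<theta> y * indicator B \<theta>) \<partial>Q) * indicator {\<tau>\<^sub>1..} \<tau> \<partial>G)"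
      by (intro nn_integral_cong) (auto simp: indicator_def)
    also have "\<dots> = W {..<\<tau>\<^sub>1} y + W {\<tau>\<^sub>1..} y"
      unfolding W_def by (intro nn_integral_add) measurable
    finally show ?thesis .
  qed
  have Z_eq: "Z y = (\<integral>\<^sup>+\<tau>. (\<Prod>j\<in>I. marginal_density f \<tau> (y j)) \<partial>G)" if y [measurable]: "y \<in> space Q" for y
  proof -
    have "Z y = (\<integral>\<^sup>+\<tau>. (\<integral>\<^sup>+\<theta>. K \<tau> \<theta> * L \<theta> y \<partial>Q) \<partial>G)"
      unfolding Z_def by (rule prior) measurable
    moreover have "(\<integral>\<^sup>+\<theta>. K \<tau> \<theta> * L \<theta> y \<partial>Q) = (\<Prod>j\<in>I. marginal_density f \<tau> (y j))" for \<tau>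
      unfolding K_def L_def Q_def marginal_density_def prod.distrib [symmetric]
      by (rule lborel_prod.product_nn_integral_prod) auto
    ultimately show ?thesis by simp
  qed
  have marg [measurable]: "(\<lambda>\<tau>. \<Prod>j\<in>I. marginal_density f \<tau> (y j)) \<in> borel_measurable G" for y
    unfolding marginal_density_def by measurable
  \<comment> \<open>The comparison holds for each \<open>\<tau> \<ge> \<tau>\<^sub>1\<close> with
    the same \<open>\<delta> y\<close>, so integrating over \<open>\<tau>\<close> produces the full
    evidence and division by \<open>Z y\<close> leaves \<open>\<delta> y\<close>.\<close>
  have W_high: "W {\<tau>\<^sub>1..} y \<le> \<delta> y * Z y" if y: "y \<in> space Q" for y
  proof -
    have "W {\<tau>\<^sub>1..} y \<le> (\<integral>\<^sup>+\<tau>. \<delta> y * (\<Prod>j\<in>I. marginal_density f \<tau> (y j)) \<partial>G)"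
      unfolding W_def
    proof (rule nn_integral_mono)
      fix \<tau>
      show "(\<integral>\<^sup>+\<theta>. K \<tau> \<theta> * (L \<theta> y * indicator B \<theta>) \<partial>Q) * indicator {\<tau>\<^sub>1..} \<tau>
        \<le> \<delta> y * (\<Prod>j\<in>I. marginal_density f \<tau> (y j))"
      proof (cases "\<tau>\<^sub>1 \<le> \<tau>")
        case True
        have "(\<integral>\<^sup>+\<theta>. K \<tau> \<theta> * (L \<theta> y * indicator B \<theta>) \<partial>Q) \<le> \<delta> y * (\<Prod>j\<in>I. marginal_density f \<tau> (y j))"
          unfolding K_def L_def Q_def \<delta>_def f_def
          by (rule nn_integral_ball_le) (use True \<tau>\<^sub>1 lam t \<kappa>(2) B_sum in auto)
        then show ?thesis using True by simp
      qed simp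
    qed
    also have "\<dots> = \<delta> y * Z y" unfolding Z_eq[OF y] by (rule nn_integral_cmult) measurable
    finally show ?thesis .
  qed
  \<comment> \<open>Lower bound for the ratio of the evidence to \<open>p y\<close>: the prior gives
    \<open>{a..2*a}\<close> mass at least \<open>a / M\<close>, and each such \<open>\<tau>\<close>
    contributes at least \<open>d * p y\<close>.\<close>
  define D where "D = a / M * d"
  have d: "d > 0" unfolding d_def using a lam by (auto intro!: mult_pos_pos zero_less_power add_pos_pos)
  have D: "D > 0" using d a M by (simp add: D_def)
  have p_pos: "p y > 0" for y unfolding p_def by (intro prod_pos) (simp add: normal_density_pos)
  have Z_ge: "ennreal (D * p y) \<le> Z y" if y: "y \<in> space Q" for y
  proof -
    have "ennreal (a / M) = (\<integral>\<^sup>+\<tau>. ennreal (1 / M) * indicator {a..2*a} \<tau> \<partial>lborel)"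
      using a M by (subst nn_integral_cmult_indicator) (auto simp: ennreal_mult [symmetric])
    also have "\<dots> \<le> (\<integral>\<^sup>+\<tau>. ennreal (g \<tau>) * indicator {0<..} \<tau> * indicator {a..2*a} \<tau> \<partial>lborel)"
      using a M(2) by (intro nn_integral_mono) (auto simp: indicator_def intro!: ennreal_leI less_imp_le[OF M(2)])
    also have "\<dots> = emeasure G {a..2*a}"
      unfolding G_def positive_law_def by (subst emeasure_density) auto
    finally have G_ge: "ennreal (a / M) \<le> emeasure G {a..2*a}" .
    have "ennreal (D * p y) = (ennreal d * ennreal (p y)) * ennreal (a / M)"
      using d a M p_pos[of y] by (simp add: D_def ennreal_mult [symmetric] mult_ac)
    also have "\<dots> \<le> (ennreal d * ennreal (p y)) * emeasure G {a..2*a}"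
      using G_ge by (rule mult_left_mono) simp
    also have "\<dots> = (\<integral>\<^sup>+\<tau>. (ennreal d * ennreal (p y)) * indicator {a..2*a} \<tau> \<partial>G)"
      by (subst nn_integral_cmult_indicator) auto
    also have "\<dots> \<le> (\<integral>\<^sup>+\<tau>. (\<Prod>j\<in>I. marginal_density f \<tau> (y j)) \<partial>G)"
    proof (rule nn_integral_mono)
      fix \<tau>
      show "(ennreal d * ennreal (p y)) * indicator {a..2*a} \<tau> \<le> (\<Prod>j\<in>I. marginal_density f \<tau> (y j))"
      proof (cases "\<tau> \<in> {a..2*a}")
        case True
        have "ennreal d * (\<Prod>j\<in>I. ennreal (normal_density (\<theta>\<^sub>0 j) 1 (y j))) \<le> (\<Prod>j\<in>I. marginal_density f \<tau> (y j))"
          unfolding d_def \<mu>_def f_def cS [symmetric]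
          by (rule prod_marginal_density_ge) (use lam a True null j0 in \<open>auto simp: I_def\<close>)
        then show ?thesis using True by (simp add: p_def prod_ennreal)
      qed simp
    qed
    finally show ?thesis using Z_eq[OF y] by simp
  qed
  have bound: "ennreal (measure (posterior n \<pi> y) B) \<le> \<delta> y + W {..<\<tau>\<^sub>1} y * ennreal (1 / (D * p y))"
    if y: "y \<in> space Q" for y
  proof -
    have Dp: "D * p y > 0" using D p_pos[of y] by simp
    \<comment> \<open>\<open>measure\<close> turns an infinite mass into 0, so this direction holds
      in any case.\<close>
    have "ennreal (measure (posterior n \<pi> y) B) \<le> emeasure (posterior n \<pi> y) B"
      by (simp add: measure_def ennreal_enn2real_if)
    also have "\<dots> \<le> \<delta> y + W {..<\<tau>\<^sub>1} y * ennreal (1 / (D * p y))"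
      unfolding post[OF y]
    proof (rule divide_le_posI_ennreal)
      have "0 < ennreal (D * p y)" using Dp by simp
      also note Z_ge[OF y]
      finally show "Z y > 0" .
      \<comment> \<open>\<open>Z y / (D * p y) \<ge> 1\<close> is inserted as a factor. This trades
        \<open>1 / Z y\<close> for a bound with \<open>p y\<close> in the denominator, which the
        density of the data cancels later.\<close>
      have "1 = ennreal (D * p y) * ennreal (1 / (D * p y))"
        using Dp D p_pos[of y] by (simp add: ennreal_mult [symmetric])
      also have "\<dots> \<le> Z y * ennreal (1 / (D * p y))" by (rule mult_right_mono[OF Z_ge[OF y]]) simp
      finally have "W {..<\<tau>\<^sub>1} y * 1 \<le> W {..<\<tau>\<^sub>1} y * (Z y * ennreal (1 / (D * p y)))"
        by (rule mult_left_mono) simp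
      then show "W {..<\<tau>\<^sub>1} y + W {\<tau>\<^sub>1..} y \<le> Z y * (\<delta> y + W {..<\<tau>\<^sub>1} y * ennreal (1 / (D * p y)))"
        using W_high[OF y] by (simp add: distrib_left mult_ac add.commute add_mono)
    qed
    finally show ?thesis .
  qed
  have mW [measurable]: "W {..<\<tau>\<^sub>1} \<in> borel_measurable Q" unfolding W_def by measurable
  have m\<delta> [measurable]: "\<delta> \<in> borel_measurable Q"
    unfolding \<delta>_def
  proof (rule borel_measurable_prod_ennreal)
    fix j assume "j \<in> ?S"
    then have [measurable]: "(\<lambda>x. x j) \<in> borel_measurable Q" using coord by simp
    show "(\<lambda>x. ennreal (exp 1 * \<kappa> * exp ((x j)\<^sup>2 / 4))) \<in> borel_measurable Q" by measurable
  qed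
  have mp [measurable]: "p \<in> borel_measurable Q"
    unfolding p_def using coord by (intro borel_measurable_prod measurable_normal_density2) auto
  have nm: "normal_means n \<theta>\<^sub>0 = density Q (\<lambda>y. ennreal (p y))"
    unfolding normal_means_def Q_def I_def p_def
    by (subst PiM_density_lborel) (auto simp: prod_ennreal)
  \<comment> \<open>Under the truth the null observations are independent standard normals, each
    contributing \<open>exp 1 * \<kappa> * sqrt 2\<close>; the signal does not enter
    \<open>\<delta>\<close> and integrates to 1.\<close>
  have int_\<delta>: "(\<integral>\<^sup>+y. ennreal (p y) * \<delta> y \<partial>Q) = ennreal ((exp 1 * \<kappa> * sqrt 2) ^ (n - 1))"
  proof -
    define w where "w j x = (if j = j0 then ennreal (normal_density \<mu> 1 x)
       else ennreal (exp 1 * \<kappa>) * (ennreal (normal_density 0 1 x) * ennreal (exp (x\<^sup>2 / 4))))" for j x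
    have "ennreal (p y) * \<delta> y = (\<Prod>j\<in>I. w j (y j))" for y
    proof -
      have "(\<Prod>j\<in>?S. ennreal (normal_density (\<theta>\<^sub>0 j) 1 (y j))) * \<delta> y = (\<Prod>j\<in>?S. w j (y j))"
        unfolding \<delta>_def prod.distrib [symmetric]
        using null \<kappa>(1) by (intro prod.cong refl) (auto simp: w_def I_def ennreal_mult mult_ac)
      then show ?thesis
        by (simp add: p_def prod_ennreal [symmetric] prod_I mult.assoc) (simp add: w_def \<mu>_def)
    qed
    then have "(\<integral>\<^sup>+y. ennreal (p y) * \<delta> y \<partial>Q) = (\<integral>\<^sup>+y. (\<Prod>j\<in>I. w j (y j)) \<partial>Q)" by simp
    also have "\<dots> = (\<Prod>j\<in>I. integral\<^sup>N lborel (w j))"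
      unfolding Q_def by (rule lborel_prod.product_nn_integral_prod) (auto simp: w_def)
    also have "\<dots> = integral\<^sup>N lborel (w j0) * (\<Prod>j\<in>?S. ennreal (exp 1 * \<kappa> * sqrt 2))"
    proof -
      have "integral\<^sup>N lborel (w j) = ennreal (exp 1 * \<kappa> * sqrt 2)" if "j \<in> ?S" for j
      proof -
        have "integral\<^sup>N lborel (w j) = (\<integral>\<^sup>+x. ennreal (exp 1 * \<kappa>) * (ennreal (normal_density 0 1 x) * ennreal (exp (x\<^sup>2 / 4))) \<partial>lborel)"
          using that by (intro nn_integral_cong) (simp add: w_def)
        also have "\<dots> = ennreal (exp 1 * \<kappa>) * ennreal (sqrt 2)"
          by (subst nn_integral_cmult) (auto simp: nn_integral_normal_density_exp_quarter)
        finally show ?thesis using \<kappa>(1) by (simp add: ennreal_mult [symmetric])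
      qed
      then show ?thesis by (simp add: prod_I)
    qed
    also have "integral\<^sup>N lborel (w j0) = (\<integral>\<^sup>+x. ennreal (normal_density \<mu> 1 x) \<partial>lborel)"
      by (intro nn_integral_cong) (simp add: w_def)
    also have "\<dots> = 1" by (rule nn_integral_normal_density) simp
    finally show ?thesis using \<kappa>(1) cS by (simp add: ennreal_power)
  qed
  have tail: "(\<integral>\<^sup>+\<theta>. K \<tau> \<theta> * indicator B \<theta> \<partial>Q) \<le> ennreal (2 * exp (- (\<bar>\<mu>\<bar> / 2) * sqrt (lam / \<tau>)))"
    if "\<tau> > 0" for \<tau>
  proof -
    define w where "w j x = scale_mixture f \<tau> x * (if j = j0 then indicator {x. \<bar>x - \<mu>\<bar> \<le> \<bar>\<mu>\<bar> / 2} x else 1)" for j :: nat and x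
    have "(\<integral>\<^sup>+\<theta>. K \<tau> \<theta> * indicator B \<theta> \<partial>Q) \<le> (\<integral>\<^sup>+\<theta>. (\<Prod>j\<in>I. w j (\<theta> j)) \<partial>Q)"
    proof (rule nn_integral_mono)
      fix \<theta>
      have "K \<tau> \<theta> = (\<Prod>j\<in>I. w j (\<theta> j))" if "\<theta> \<in> B"
        unfolding K_def using B_j0[OF that] by (intro prod.cong) (auto simp: w_def)
      then show "K \<tau> \<theta> * indicator B \<theta> \<le> (\<Prod>j\<in>I. w j (\<theta> j))" by (cases "\<theta> \<in> B") auto
    qed
    also have "\<dots> = (\<Prod>j\<in>I. integral\<^sup>N lborel (w j))"
      unfolding Q_def by (rule lborel_prod.product_nn_integral_prod) (auto simp: w_def)
    also have "\<dots> = integral\<^sup>N lborel (w j0) * (\<Prod>j\<in>?S. integral\<^sup>N lborel (w j))" by (rule prod_I)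
    also have "\<dots> \<le> integral\<^sup>N lborel (w j0) * 1"
    proof (intro mult_left_mono prod_le_1)
      fix j assume "j \<in> ?S"
      then have "integral\<^sup>N lborel (w j) = (\<integral>\<^sup>+x. scale_mixture f \<tau> x \<partial>lborel)"
        by (intro nn_integral_cong) (simp add: w_def)
      then show "0 \<le> integral\<^sup>N lborel (w j) \<and> integral\<^sup>N lborel (w j) \<le> 1"
        using nn_integral_scale_mixture_le[OF f prob_f, of \<tau>] by simp
    qed simp
    also have "integral\<^sup>N lborel (w j0) * 1 = (\<integral>\<^sup>+x. scale_mixture f \<tau> x * indicator {x. \<bar>x - \<mu>\<bar> \<le> \<bar>\<mu>\<bar> / 2} x \<partial>lborel)"
      by (simp add: w_def cong: nn_integral_cong)
    also have "\<dots> \<le> ennreal (2 * exp (- (\<bar>\<mu>\<bar> / 2) * sqrt (lam / \<tau>)))"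
      unfolding f_def by (rule scale_mixture_exponential_tail[OF lam that])
    finally show ?thesis .
  qed
  \<comment> \<open>With \<open>p y\<close> cancelled, \<open>y\<close> is integrated against
    Lebesgue measure, where the likelihood has mass 1 for each \<open>\<theta>\<close>. Only the
    prior mass of the ball remains, and its tail bound increases in \<open>\<tau>\<close> up to the
    value at \<open>\<tau>\<^sub>1\<close>.\<close>
  have int_W: "(\<integral>\<^sup>+y. W {..<\<tau>\<^sub>1} y \<partial>Q) \<le> ennreal (2 * exp (- (\<bar>\<mu>\<bar> / 2) * sqrt (lam / \<tau>\<^sub>1)))" (is "_ \<le> ?E")
  proof -
    have L1: "(\<integral>\<^sup>+y. L \<theta> y \<partial>Q) = 1" for \<theta>
      unfolding L_def Q_def
      by (subst lborel_prod.product_nn_integral_prod) (auto simp: nn_integral_normal_density)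
    have "(\<integral>\<^sup>+y. W {..<\<tau>\<^sub>1} y \<partial>Q)
      = (\<integral>\<^sup>+\<tau>. (\<integral>\<^sup>+y. (\<integral>\<^sup>+\<theta>. K \<tau> \<theta> * (L \<theta> y * indicator B \<theta>) \<partial>Q) * indicator {..<\<tau>\<^sub>1} \<tau> \<partial>Q) \<partial>G)"
      unfolding W_def by (rule QG.Fubini'[symmetric]) measurable
    also have "\<dots> \<le> (\<integral>\<^sup>+\<tau>. ?E \<partial>G)"
    proof (rule nn_integral_mono_AE)
      show "AE \<tau> in G. (\<integral>\<^sup>+y. (\<integral>\<^sup>+\<theta>. K \<tau> \<theta> * (L \<theta> y * indicator B \<theta>) \<partial>Q) * indicator {..<\<tau>\<^sub>1} \<tau> \<partial>Q) \<le> ?E"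
        using G_pos
      proof eventually_elim
        fix \<tau> :: real assume "\<tau> > 0"
        show "(\<integral>\<^sup>+y. (\<integral>\<^sup>+\<theta>. K \<tau> \<theta> * (L \<theta> y * indicator B \<theta>) \<partial>Q) * indicator {..<\<tau>\<^sub>1} \<tau> \<partial>Q) \<le> ?E"
        proof (cases "\<tau> < \<tau>\<^sub>1")
          case True
          have "(\<integral>\<^sup>+y. (\<integral>\<^sup>+\<theta>. K \<tau> \<theta> * (L \<theta> y * indicator B \<theta>) \<partial>Q) \<partial>Q)
             = (\<integral>\<^sup>+\<theta>. (\<integral>\<^sup>+y. K \<tau> \<theta> * (L \<theta> y * indicator B \<theta>) \<partial>Q) \<partial>Q)"
            by (rule QQ.Fubini'[symmetric]) measurable
          also have "\<dots> = (\<integral>\<^sup>+\<theta>. (\<integral>\<^sup>+y. (K \<tau> \<theta> * indicator B \<theta>) * L \<theta> y \<partial>Q) \<partial>Q)"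
            by (simp only: mult_ac)
          also have "\<dots> = (\<integral>\<^sup>+\<theta>. K \<tau> \<theta> * indicator B \<theta> \<partial>Q)"
            by (intro nn_integral_cong, subst nn_integral_cmult) (auto simp: L1)
          also have "\<dots> \<le> ennreal (2 * exp (- (\<bar>\<mu>\<bar> / 2) * sqrt (lam / \<tau>)))" by (rule tail) fact
          also have "\<dots> \<le> ?E"
          proof -
            have "sqrt (lam / \<tau>\<^sub>1) \<le> sqrt (lam / \<tau>)"
              using True \<open>\<tau> > 0\<close> lam by (simp add: divide_left_mono)
            then have "(\<bar>\<mu>\<bar> / 2) * sqrt (lam / \<tau>\<^sub>1) \<le> (\<bar>\<mu>\<bar> / 2) * sqrt (lam / \<tau>)"
              by (intro mult_left_mono) auto
            then show ?thesis by (intro ennreal_leI) simp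
          qed
          finally show ?thesis using True by simp
        qed simp
      qed
    qed
    also have "\<dots> = ?E" using G1 by (simp add: G_def)
    finally show ?thesis .
  qed
  have "(\<integral>\<^sup>+y. ennreal (measure (posterior n \<pi> y) B) \<partial>normal_means n \<theta>\<^sub>0)
     \<le> (\<integral>\<^sup>+y. \<delta> y + W {..<\<tau>\<^sub>1} y * ennreal (1 / (D * p y)) \<partial>normal_means n \<theta>\<^sub>0)"
    by (intro nn_integral_mono bound) (simp add: nm)
  also have "\<dots> = (\<integral>\<^sup>+y. ennreal (p y) * (\<delta> y + W {..<\<tau>\<^sub>1} y * ennreal (1 / (D * p y))) \<partial>Q)"
    unfolding nm by (rule nn_integral_density) measurable
  also have "\<dots> = (\<integral>\<^sup>+y. ennreal (p y) * \<delta> y + W {..<\<tau>\<^sub>1} y * ennreal (1 / D) \<partial>Q)"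
  proof (rule nn_integral_cong)
    fix y
    have "ennreal (p y) * ennreal (1 / (D * p y)) = ennreal (1 / D)"
      using p_pos[of y] D by (subst ennreal_mult [symmetric]) auto
    then show "ennreal (p y) * (\<delta> y + W {..<\<tau>\<^sub>1} y * ennreal (1 / (D * p y)))
      = ennreal (p y) * \<delta> y + W {..<\<tau>\<^sub>1} y * ennreal (1 / D)"
      by (metis distrib_left mult.left_commute)
  qed
  also have "\<dots> = (\<integral>\<^sup>+y. ennreal (p y) * \<delta> y \<partial>Q) + (\<integral>\<^sup>+y. W {..<\<tau>\<^sub>1} y \<partial>Q) * ennreal (1 / D)"
    by (subst nn_integral_add, measurable) (simp add: nn_integral_multc)
  also have "\<dots> \<le> ennreal ((exp 1 * \<kappa> * sqrt 2) ^ (n - 1)) + ?E * ennreal (1 / D)"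
    by (intro add_mono mult_right_mono int_W) (auto simp: int_\<delta>)
  also have "\<dots> = ennreal ((exp 1 * \<kappa> * sqrt 2) ^ (n - 1) + 2 * exp (- (\<bar>\<mu>\<bar> / 2) * sqrt (lam / \<tau>\<^sub>1)) / D)"
    using D \<kappa>(1) by (subst ennreal_mult [symmetric], simp, simp, subst ennreal_plus [symmetric]) auto
  \<comment> \<open>Passing to the Bochner integral asks only for a nonnegative bound: a function
    that is not integrable has integral 0 by default.\<close>
  finally have "(\<integral>y. measure (posterior n \<pi> y) B \<partial>normal_means n \<theta>\<^sub>0)
     \<le> (exp 1 * \<kappa> * sqrt 2) ^ (n - 1) + 2 * exp (- (\<bar>\<mu>\<bar> / 2) * sqrt (lam / \<tau>\<^sub>1)) / D"
    using D \<kappa>(1) by (intro integral_real_bounded) (auto intro!: add_nonneg_nonneg)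
  then show ?thesis by (simp only: \<pi>_def D_def)
qed

section \<open>Asymptotics\<close>

lemma l0_ball_1_obtain:
  assumes "\<theta> \<in> l0_ball 1 n" "L2_set \<theta> {1..n} > 0"
  obtains j where "j \<in> {1..n}" "\<And>i. i \<in> {1..n} - {j} \<Longrightarrow> \<theta> i = 0" "\<bar>\<theta> j\<bar> = L2_set \<theta> {1..n}"
proof -
  let ?N = "{j \<in> {1..n}. \<theta> j \<noteq> 0}"
  have "card ?N \<le> Suc 0" using assms(1) by (simp add: l0_ball_def)
  then have N: "\<And>i j. i \<in> ?N \<Longrightarrow> j \<in> ?N \<Longrightarrow> i = j" by (subst (asm) card_le_Suc0_iff_eq) auto
  have "\<exists>j\<in>{1..n}. \<theta> j \<noteq> 0"
    using assms(2) L2_set_eq_0_iff[of "{1..n}" \<theta>] by auto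
  then obtain j where j: "j \<in> {1..n}" "\<theta> j \<noteq> 0" by blast
  then have null: "\<theta> i = 0" if "i \<in> {1..n} - {j}" for i using N[of i j] that by auto
  have "(\<Sum>i\<in>{1..n}. (\<theta> i)\<^sup>2) = (\<Sum>i\<in>{j}. (\<theta> i)\<^sup>2)"
    using j null by (intro sum.mono_neutral_right) auto
  then have "\<bar>\<theta> j\<bar> = L2_set \<theta> {1..n}" by (simp add: L2_set_def)
  with j(1) null show thesis by (rule that)
qed

text \<open>A consequence of \<open>1 + x \<le> exp x\<close>; it controls the price of the
  \<open>n - 1\<close> null coordinates in the evidence.\<close>

lemma inverse_sqrt_power_ge:
  assumes "x \<ge> 0"
  shows "exp (- (real m * x / 2)) \<le> (1 / sqrt (1 + x)) ^ m"
proof -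
  have "sqrt (1 + x) \<le> sqrt (exp x)" by (rule real_sqrt_le_mono) (rule exp_ge_add_one_self)
  also have "\<dots> = exp (x / 2)"
    using exp_double[of "x / 2"] by (simp add: real_sqrt_unique)
  finally have "1 / exp (x / 2) \<le> 1 / sqrt (1 + x)" using assms by (intro divide_left_mono) auto
  then have "exp (- (x / 2)) \<le> 1 / sqrt (1 + x)" by (simp add: exp_minus inverse_eq_divide)
  then have "exp (- (x / 2)) ^ m \<le> (1 / sqrt (1 + x)) ^ m" by (rule power_mono) simp
  then show ?thesis by (simp add: exp_of_nat_mult [symmetric])
qed

theorem theorem4p2:
  fixes lam A :: real and g :: "real \<Rightarrow> real" and \<theta>\<^sub>0 :: "nat \<Rightarrow> nat \<Rightarrow> real"
  assumes "g \<in> class_G" and "lam > 0"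
    and "\<And>n. n \<ge> 1 \<Longrightarrow> \<theta>\<^sub>0 n \<in> l0_ball 1 n"
    and "filterlim (\<lambda>n. (L2_set (\<theta>\<^sub>0 n) {1..n})\<^sup>2 / ln (real n)) at_top sequentially"
    and "A > 0"
  shows "(\<lambda>n. \<integral>y. measure (posterior n (global_local_prior (exponential_density lam) g n) y)
                 {\<theta> \<in> {1..n} \<rightarrow>\<^sub>E UNIV. L2_set (\<lambda>j. \<theta> j - \<theta>\<^sub>0 n j) {1..n} \<le> sqrt (A * ln (real n))}
               \<partial>normal_means n (\<theta>\<^sub>0 n)) \<longlonglongrightarrow> 0"
    (is "?P \<longlonglongrightarrow> 0")
proof -
  note lam = assms(2) and A = assms(5)
  obtain M where g: "g \<in> borel_measurable borel" "(\<integral>\<^sup>+t\<in>{0<..}. ennreal (g t) \<partial>lborel) = 1"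
    and M: "M > 0" "\<And>t. 0 < t \<Longrightarrow> t < 1 \<Longrightarrow> g t > 1 / M"
    using assms(1) unfolding class_G_def by auto
  define r where "r n = L2_set (\<theta>\<^sub>0 n) {1..n}" for n
  \<comment> \<open>Makes \<open>exp 1 * \<kappa> * sqrt 2\<close> equal to 1/2, so that the first
    summand of the bound is geometric.\<close>
  define \<kappa> where "\<kappa> = 1 / (2 * exp 1 * sqrt 2 :: real)"
  \<comment> \<open>Makes \<open>(2 * lam + 1)\<^sup>2 / \<tau>\<^sub>1 n\<close> equal to
    \<open>\<kappa>\<^sup>2 * n / (A * ln n)\<close>, half of the leading term of
    \<open>2 * \<kappa>\<^sup>2 * t n\<close>.\<close>
  define K where "K = (2 * lam + 1)\<^sup>2 * A / \<kappa>\<^sup>2"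
  \<comment> \<open>Makes \<open>c * sqrt (ln n)\<close> times a quarter of
    \<open>sqrt (lam / \<tau>\<^sub>1 n)\<close> equal to \<open>(1 / lam + 2) * sqrt n\<close>: the
    cost \<open>sqrt n / lam\<close> of the null coordinates and a margin of
    \<open>2 * sqrt n\<close>.\<close>
  define c where "c = 4 * (1 / lam + 2) / sqrt (lam / K)"
  have \<kappa>: "\<kappa> > 0" by (simp add: \<kappa>_def)
  have K: "K > 0" using lam A \<kappa> by (simp add: K_def)
  have c: "c > 0" using lam K by (simp add: c_def add_pos_pos)
  \<comment> \<open>The largest tilt that the ball allows:
    \<open>t n * \<rho>\<^sup>2 = n - 1\<close> for
    \<open>\<rho>\<^sup>2 = A * ln n\<close>.\<close>
  define t where "t n = (real n - 1) / (A * ln (real n))" for n :: nat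
  define \<tau>\<^sub>1 where "\<tau>\<^sub>1 n = K * ln (real n) / real n" for n :: nat
  define a where "a n = 1 / sqrt (real n)" for n :: nat
  \<comment> \<open>The bound after \<open>r n\<close> has been eliminated; the factor
    \<open>sqrt n\<close> comes from \<open>1 / a n\<close>.\<close>
  define U where "U n = (1 / 2) ^ (n - 1) + 8 * M * exp (1/2) * sqrt (real n)
      * exp (- 2 * sqrt (real n) + (5/2) * sqrt (lam * sqrt (real n)))" for n :: nat
  have U_lim: "U \<longlonglongrightarrow> 0"
  proof -
    have "(\<lambda>n. (1 / 2 :: real) ^ (n - 1)) \<longlonglongrightarrow> 0" by real_asymp
    moreover have "(\<lambda>n. 8 * M * exp (1/2) * sqrt (real n)
      * exp (- 2 * sqrt (real n) + (5/2) * sqrt (lam * sqrt (real n)))) \<longlonglongrightarrow> 0"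
      using M lam by real_asymp
    ultimately show ?thesis unfolding U_def using tendsto_add by fastforce
  qed
  have r_ge: "\<forall>\<^sub>F n in sequentially. b * sqrt (ln (real n)) \<le> r n" if "b \<ge> 0" for b
  proof -
    have "\<forall>\<^sub>F n in sequentially. b\<^sup>2 \<le> (r n)\<^sup>2 / ln (real n)"
      using assms(4) unfolding filterlim_at_top r_def by blast
    moreover have "\<forall>\<^sub>F n in sequentially. ln (real n) > 0" by real_asymp
    ultimately show ?thesis
    proof eventually_elim
      case (elim n)
      then have "(b * sqrt (ln (real n)))\<^sup>2 \<le> (r n)\<^sup>2" by (simp add: power_mult_distrib field_simps)
      then show ?case by (rule power2_le_imp_le) (simp add: r_def)
    qed
  qed
  have upper: "\<forall>\<^sub>F n in sequentially. ?P n \<le> U n"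
  proof -
    \<comment> \<open>The condition on \<open>\<kappa>\<close> in
      \<open>integral_posterior_le\<close> at \<open>\<tau> = \<tau>\<^sub>1 n\<close>, squared and
      divided by \<open>\<tau>\<close>. The right-hand side is asymptotically twice the first term,
      which leaves room for the constant.\<close>
    have "\<forall>\<^sub>F n in sequentially. \<kappa>\<^sup>2 * (real n / (A * ln (real n))) + (2 * lam + 1)\<^sup>2 / lam
        \<le> 2 * \<kappa>\<^sup>2 * (t n - 1 / 2)"
      unfolding t_def using A \<kappa> by real_asymp
    moreover have "\<forall>\<^sub>F n in sequentially. t n > 1 / 2"
      unfolding t_def using A by real_asymp
    moreover have "\<forall>\<^sub>F n in sequentially. 2 * a n < 1" unfolding a_def by real_asymp
    moreover have "\<forall>\<^sub>F n in sequentially. 2 * a n \<le> lam" unfolding a_def using lam by real_asymp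
    moreover have "\<forall>\<^sub>F n in sequentially. n \<ge> 1 \<and> ln (real n) > 0"
      by (intro eventually_conj eventually_ge_at_top) real_asymp
    moreover have "\<forall>\<^sub>F n in sequentially. (5/2) * sqrt (lam * sqrt (real n)) \<le> 1/4 * sqrt (lam / (K * ln (real n) / real n))"
      using lam K by real_asymp
    moreover have "\<forall>\<^sub>F n in sequentially. 2 * sqrt A * sqrt (ln (real n)) \<le> r n" by (rule r_ge) (use A in simp)
    moreover have "\<forall>\<^sub>F n in sequentially. c * sqrt (ln (real n)) \<le> r n" by (rule r_ge) (use c in simp)
    ultimately show ?thesis
    proof eventually_elim
      case (elim n)
      note key = elim(1) and t = elim(2) and a1 = elim(3) and a2 = elim(4) and q = elim(6) and r1 = elim(7) and r2 = elim(8)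
      have n: "n \<ge> 1" "real n > 0" and ln: "ln (real n) > 0" using elim(5) by auto
      have "0 < 2 * sqrt A * sqrt (ln (real n))" using A ln by simp
      then have rpos: "r n > 0" using r1 by linarith
      obtain j where j: "j \<in> {1..n}" "\<And>i. i \<in> {1..n} - {j} \<Longrightarrow> \<theta>\<^sub>0 n i = 0" "\<bar>\<theta>\<^sub>0 n j\<bar> = r n"
        using l0_ball_1_obtain[OF assms(3)[OF n(1)]] rpos unfolding r_def by blast
      have a0: "a n > 0" using n by (simp add: a_def)
      have \<tau>\<^sub>1: "\<tau>\<^sub>1 n > 0" using K ln n by (simp add: \<tau>\<^sub>1_def)
      \<comment> \<open>\<open>1 / \<tau>\<close> is largest at \<open>\<tau>\<^sub>1 n\<close>, so
        the inequality there carries over to all larger \<open>\<tau>\<close>.\<close>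
      have \<kappa>_bound: "(2 * lam + 1) / sqrt (2 * (t n - 1/2) * \<tau>) \<le> \<kappa> / sqrt (1 + \<tau> / lam)" if "\<tau>\<^sub>1 n \<le> \<tau>" for \<tau>
      proof -
        have tau: "\<tau> > 0" using \<tau>\<^sub>1 that by simp
        have "(2 * lam + 1)\<^sup>2 * (1 / \<tau>) \<le> (2 * lam + 1)\<^sup>2 * (1 / \<tau>\<^sub>1 n)"
          using that tau \<tau>\<^sub>1 by (intro mult_left_mono divide_left_mono) auto
        also have "\<dots> = \<kappa>\<^sup>2 * (real n / (A * ln (real n)))"
          using lam \<kappa> A ln n by (simp add: \<tau>\<^sub>1_def K_def field_simps)
        finally have "(2 * lam + 1)\<^sup>2 * (1 / \<tau>) + (2 * lam + 1)\<^sup>2 / lam \<le> 2 * \<kappa>\<^sup>2 * (t n - 1 / 2)"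
          using key by linarith
        then have "((2 * lam + 1)\<^sup>2 * (1 / \<tau>) + (2 * lam + 1)\<^sup>2 / lam) * \<tau> \<le> 2 * \<kappa>\<^sup>2 * (t n - 1 / 2) * \<tau>"
          using tau by (intro mult_right_mono) auto
        moreover have "((2 * lam + 1)\<^sup>2 * (1 / \<tau>) + (2 * lam + 1)\<^sup>2 / lam) * \<tau> = (2 * lam + 1)\<^sup>2 * (1 + \<tau> / lam)"
          using tau lam by (simp add: distrib_right distrib_left)
        moreover have "2 * \<kappa>\<^sup>2 * (t n - 1 / 2) * \<tau> = \<kappa>\<^sup>2 * (2 * (t n - 1/2) * \<tau>)"
          by (simp only: mult_ac)
        ultimately have "(2 * lam + 1)\<^sup>2 * (1 + \<tau> / lam) \<le> \<kappa>\<^sup>2 * (2 * (t n - 1/2) * \<tau>)"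
          by linarith
        then have "sqrt ((2 * lam + 1)\<^sup>2 * (1 + \<tau> / lam)) \<le> sqrt (\<kappa>\<^sup>2 * (2 * (t n - 1/2) * \<tau>))"
          by (rule real_sqrt_le_mono)
        then have "(2 * lam + 1) * sqrt (1 + \<tau> / lam) \<le> \<kappa> * sqrt (2 * (t n - 1/2) * \<tau>)"
          using lam \<kappa> by (simp only: real_sqrt_mult real_sqrt_abs)
        moreover have "sqrt (1 + \<tau> / lam) > 0" using tau lam by (simp add: add_pos_pos)
        moreover have "sqrt (2 * (t n - 1/2) * \<tau>) > 0" using tau t by simp
        moreover have "x / s \<le> k / u" if "x * u \<le> k * s" "u > 0" "s > 0" for x s k u :: real
          using that by (simp add: field_simps)
        ultimately show ?thesis by blast
      qed
      define d where "d = (1 / sqrt (1 + 2 * a n / lam)) ^ (n - 1) *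
        (exp (- (1/2)) * (exp (- (5/2) * (r n + 1) * sqrt (lam / a n)) / 4))"
      have P: "?P n \<le> (exp 1 * \<kappa> * sqrt 2) ^ (n - 1) + 2 * exp (- (r n / 2) * sqrt (lam / \<tau>\<^sub>1 n)) / (a n / M * d)"
        unfolding d_def j(3) [symmetric]
      proof (rule integral_posterior_le)
        show "sqrt (A * ln (real n)) \<le> \<bar>\<theta>\<^sub>0 n j\<bar> / 2" using r1 by (simp add: j(3) real_sqrt_mult)
        show "t n * (sqrt (A * ln (real n)))\<^sup>2 \<le> real (n - 1)"
          using A ln n by (simp add: t_def of_nat_diff)
      qed (use lam g M j \<tau>\<^sub>1 \<kappa> \<kappa>_bound a0 a1 a2 t in auto)
      have d_ge: "exp (- (sqrt (real n) / lam) - 1/2 - (5/2) * (r n + 1) * sqrt (lam * sqrt (real n))) / 4 \<le> d"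
      proof -
        have "real (n - 1) * (2 * a n / lam) / 2 \<le> real n * (2 * a n / lam) / 2"
          using a0 lam by (intro divide_right_mono mult_right_mono) auto
        also have "\<dots> = real n / sqrt (real n) / lam" by (simp add: a_def)
        also have "\<dots> = sqrt (real n) / lam" by (simp only: real_div_sqrt of_nat_0_le_iff)
        finally have "exp (- (sqrt (real n) / lam)) \<le> exp (- (real (n - 1) * (2 * a n / lam) / 2))" by simp
        also have "\<dots> \<le> (1 / sqrt (1 + 2 * a n / lam)) ^ (n - 1)"
          by (rule inverse_sqrt_power_ge) (use a0 lam in simp)
        finally have "exp (- (sqrt (real n) / lam)) * (exp (- (1/2)) * (exp (- (5/2) * (r n + 1) * sqrt (lam / a n)) / 4)) \<le> d"
          unfolding d_def by (rule mult_right_mono) simp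
        moreover have "lam / a n = lam * sqrt (real n)" by (simp add: a_def)
        moreover have "exp (- (sqrt (real n) / lam) - 1/2 - (5/2) * (r n + 1) * sqrt (lam * sqrt (real n)))
          = exp (- (sqrt (real n) / lam)) * (exp (- (1/2)) * exp (- (5/2) * (r n + 1) * sqrt (lam * sqrt (real n))))"
          by (simp add: exp_add [symmetric])
        ultimately show ?thesis by simp
      qed
      let ?w = "sqrt (lam / \<tau>\<^sub>1 n)" and ?v = "sqrt (lam * sqrt (real n))"
      let ?x = "sqrt (real n) / lam + 1/2 + (5/2) * (r n + 1) * ?v"
      have "2 * exp (- (r n / 2) * ?w) / (a n / M * d) \<le> 2 * exp (- (r n / 2) * ?w) / (a n / M * (exp (- ?x) / 4))"
      proof (intro divide_left_mono mult_left_mono)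
        have "- ?x = - (sqrt (real n) / lam) - 1/2 - (5/2) * (r n + 1) * ?v" by simp
        with d_ge show "exp (- ?x) / 4 \<le> d" by (simp only:)
        then have "d > 0" by (rule less_le_trans[rotated]) simp
        then show "0 < a n / M * d * (a n / M * (exp (- ?x) / 4))" using a0 M by simp
      qed (use a0 M in auto)
      also have "\<dots> = 8 * M * sqrt (real n) * exp (?x - r n / 2 * ?w)"
      proof -
        have "2 * e / (1 / s / M * (y / 4)) = 8 * M * s * (e / y)" if "s > 0" "y > 0" for e s y
          using that M(1) by (simp add: field_simps)
        moreover have "exp (?x - r n / 2 * ?w) = exp (- (r n / 2) * ?w) / exp (- ?x)"
          by (subst exp_diff [symmetric], rule arg_cong[where f = exp]) simp
        ultimately show ?thesis using n by (simp only: a_def real_sqrt_gt_0_iff exp_gt_zero)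
      qed
      \<comment> \<open>The gain \<open>r n / 2 * ?w\<close> is split into two quarters of
        \<open>r n * ?w\<close>: one pays for the signal's cost proportional to \<open>r n\<close>,
        the other for \<open>sqrt n / lam\<close> and the margin \<open>2 * sqrt n\<close>. The 1 in
        \<open>r n + 1\<close> leaves \<open>5/2 * ?v\<close>, of lower order than
        \<open>sqrt n\<close>.\<close>
      also have "\<dots> \<le> 8 * M * sqrt (real n) * exp (1/2 + (- 2 * sqrt (real n) + (5/2) * ?v))"
      proof -
        have "r n * ((5/2) * ?v) \<le> r n * (1/4 * ?w)"
          using q rpos by (intro mult_left_mono) (auto simp: \<tau>\<^sub>1_def)
        moreover have "(1 / lam + 2) * sqrt (real n) \<le> r n * (1/4 * ?w)"
        proof -
          have "?w = sqrt (lam / K) * sqrt (real n) / sqrt (ln (real n))"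
            by (simp add: \<tau>\<^sub>1_def real_sqrt_mult real_sqrt_divide)
          then have "(1 / lam + 2) * sqrt (real n) = c * sqrt (ln (real n)) * (1/4 * ?w)"
            using lam K ln by (simp add: c_def)
          also have "\<dots> \<le> r n * (1/4 * ?w)" using r2 lam \<tau>\<^sub>1 by (intro mult_right_mono) auto
          finally show ?thesis .
        qed
        moreover have "(1 / lam + 2) * sqrt (real n) = sqrt (real n) / lam + 2 * sqrt (real n)"
          "(5/2) * (r n + 1) * ?v = r n * ((5/2) * ?v) + (5/2) * ?v"
          "r n / 2 * ?w = 2 * (r n * (1/4 * ?w))"
          by (simp_all add: algebra_simps)
        ultimately have "?x - r n / 2 * ?w \<le> 1/2 + (- 2 * sqrt (real n) + (5/2) * ?v)"
          by linarith
        then show ?thesis using M by (intro mult_left_mono) auto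
      qed
      also have "\<dots> = 8 * M * exp (1/2) * sqrt (real n) * exp (- 2 * sqrt (real n) + (5/2) * ?v)"
        by (simp only: exp_add mult_ac)
      finally have "2 * exp (- (r n / 2) * ?w) / (a n / M * d) \<le> \<dots>" .
      moreover have "exp 1 * \<kappa> * sqrt 2 = 1 / 2" by (simp add: \<kappa>_def)
      note P [unfolded this]
      ultimately show ?case unfolding U_def by linarith
    qed
  qed
  have lower: "\<forall>\<^sub>F n in sequentially. 0 \<le> ?P n" by (simp add: integral_nonneg)
  show ?thesis by (rule tendsto_sandwich[OF lower upper tendsto_const U_lim])
qed

end
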